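(* Let $X$ be a complete $RN$ module over $K$ with base $(\Omega,\mathcal F,P)$, let $A:D(A)\to X$ be a module homomorphism with $D(A)\subseteq X$, and let $C\in B(X)$. For $z\in X$ consider the abstract Cauchy problem $$\mathrm{ACP}(z):\qquad \frac{dW(s,z)}{ds}=AW(s,z)\ \ (s>0),\qquad W(0,z)=z .$$ (a) Let $\{V(s):s\ge 0\}$ be a mild $C$-existence family for $A$. Then for any $z\in R(C)$ there is a mild solution of $\mathrm{ACP}(z)$. Further, for any sequence $z_n\in X$ with $z_n\to 0$ $(n\to\infty)$, the functions $W(s,Cz_n)\equiv V(s)z_n$, which are mild solutions of $\mathrm{ACP}(Cz_n)$, converge to $0$ uniformly for $s$ in any compact subset of $[0,\infty)$ as $n\to\infty$. (b) Let $\{V(s):s\ge 0\}$ be a $C$-existence family for $A$. Then for any $z\in C(D(A))$ there is a solution of $\mathrm{ACP}(z)$. Further, for any sequence $z_n\in D(A)$ with $z_n\to 0$ and $Az_n\to 0$, both $W(s,Cz_n)\equiv V(s)z_n\to 0$ and $AW(s,Cz_n)\to 0$ uniformly for $s$ in any compact subset of $[0,\infty)$.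
   Context: $(\Omega,\mathcal F,P)$ is a probability space, $K=\mathbb R$ or $\mathbb C$, $L^0(\mathcal F,K)$ is the algebra of equivalence classes (a.s. equality) of $K$-valued $\mathcal F$-measurable random variables, $\bar L^0(\mathcal F,R)$ the complete lattice of equivalence classes of extended real-valued random variables under a.s. order, and $L^0_+(\mathcal F)=\{\xi\in L^0(\mathcal F,R):\xi\ge 0\}$. $\bigvee$ and $\bigwedge$ denote supremum and infimum in $\bar L^0(\mathcal F,R)$. An $RN$ module over $K$ with base $(\Omega,\mathcal F,P)$ is an $L^0(\mathcal F,K)$-module $X$ with a map $\|\cdot\|:X\to L^0_+(\mathcal F)$ (the $L^0$-norm) such that $\|\xi x\|=|\xi|\|x\|$ for all $\xi\in L^0(\mathcal F,K)$, $x\in X$; $\|x+y\|\le\|x\|+\|y\|$; and $\|x\|=0$ implies $x=0$. It carries the $(\varepsilon,\lambda)$-topology, the metrizable linear topology with local base at $0$ given by $\{z: P(\|z\|<\varepsilon)>\lambda\}$, $\varepsilon>0$, $0<\lambda<1$; so $z_n\to z$ iff $\|z_n-z\|\to0$ in probability. Completeness, limits, continuity, derivatives (one-sided at endpoints) and Riemann integrals (limits of Riemann sums) are in this topology. A linear operator $T:X_1\to X_2$ between $RN$ modules is a.s. bounded if there is $\eta\in L^0_+(\mathcal F)$ with $\|Tz\|\le\eta\|z\|$ for all $z$; $B(X_1,X_2)$ is the set of these (equivalently, the continuous module homomorphisms), $B(X)=B(X,X)$, and $\|T\|=\bigwedge\{\eta\in L^0_+(\mathcal F):\|Tz\|\le\eta\|z\|\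 \forall z\}$. A module homomorphism is an $L^0(\mathcal F,K)$-linear map. $R(C)$ is the range of $C$. $[D(A)]$ is the $RN$ module $D(A)$ with the graph $L^0$-norm $\|z\|_{[D(A)]}=\|z\|+\|Az\|$. A family $\{V(s):s\ge0\}$ of continuous module homomorphisms is locally a.s. bounded if $\bigvee_{s\in[0,l]}\|V(s)\|\in L^0_+(\mathcal F)$ for every $l>0$. Mild $C$-existence family for $A$: a locally a.s. bounded family $\{V(s):s\ge0\}\subseteq B(X)$ such that (1) $s\mapsto V(s)z$ is continuous from $[0,\infty)$ to $X$ for every $z\in X$; (2) for every $z\in X$, $s\ge0$, $\int_0^sV(u)z\,du\in D(A)$ and $A\int_0^sV(u)z\,du=V(s)z-Cz$. $C$-existence family for $A$: a locally a.s. bounded (with respect to the operator $L^0$-norm of $B([D(A)])$) family $\{V(s):s\ge0\}\subseteq B([D(A)])$ such that (1) $s\mapsto V(s)z$ is continuous from $[0,\infty)$ to $[D(A)]$ for every $z\in D(A)$; (2) for every $z\in D(A)$, $s\ge0$, $\int_0^sAV(u)z\,du=V(s)z-Cz$. A solution of $\mathrm{ACP}(z)$ is a map $s\mapsto W(s,z)$ in $C([0,\infty),[D(A)])\cap C^1([0,\infty),X)$ satisfying $\mathrm{ACP}(z)$. A mild solution of $\mathrm{ACP}(z)$ is a map $s\mapsto W(s,z)$ in $C([0,\infty),X)$ with $\bigvee_{u\in[0,s]}\|W(u,z)\|\in L^0_+(\mathcal F)$ for each $s\ge0$, such that for every $s\ge0$, $\int_0^sW(u,z)\,du\in D(A)$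 and $W(s,z)=A\int_0^sW(u,z)\,du+z$. *)

theory Defs
  imports "HOL-Probability.Probability_Measure" "HOL-Algebra.Module" "HOL-Algebra.Complete_Lattice"
begin

section \<open>Classes of random variables\<close>

definition ae_rel :: "'w measure \<Rightarrow> (('w \<Rightarrow> 'a::topological_space) \<times> ('w \<Rightarrow> 'a)) set" where
  "ae_rel M = {(f, g). f \<in> borel_measurable M \<and> g \<in> borel_measurable M \<and> (AE w in M. f w = g w)}"

text \<open>Taken at \<^typ>\<open>real\<close>, \<^typ>\<open>complex\<close> and \<^typ>\<open>ereal\<close> this gives $L^0(F,R)$, $L^0(F,C)$ and the
  lattice $\bar L^0(F,R)$ of extended real-valued classes.\<close>

definition L0 :: "'w measure \<Rightarrow> ('w \<Rightarrow> 'a::topological_space) set set" where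
  "L0 M = borel_measurable M // ae_rel M"

definition L0_const :: "'w measure \<Rightarrow> 'a::topological_space \<Rightarrow> ('w \<Rightarrow> 'a) set" where
  "L0_const M c = ae_rel M `` {\<lambda>_. c}"

definition L0_map :: "'w measure \<Rightarrow> ('a \<Rightarrow> 'b::topological_space) \<Rightarrow> ('w \<Rightarrow> 'a) set \<Rightarrow> ('w \<Rightarrow> 'b) set" where
  "L0_map M h a = (\<Union>f\<in>a. ae_rel M `` {\<lambda>w. h (f w)})"

definition L0_map2 :: "'w measure \<Rightarrow> ('a \<Rightarrow> 'b \<Rightarrow> 'c::topological_space) \<Rightarrow>
    ('w \<Rightarrow> 'a) set \<Rightarrow> ('w \<Rightarrow> 'b) set \<Rightarrow> ('w \<Rightarrow> 'c) set" where
  "L0_map2 M h a b = (\<Union>f\<in>a. \<Union>g\<in>b. ae_rel M `` {\<lambda>w. h (f w) (g w)})"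

definition L0_le :: "'w measure \<Rightarrow> ('w \<Rightarrow> 'a::order) set \<Rightarrow> ('w \<Rightarrow> 'a) set \<Rightarrow> bool" where
  "L0_le M a b \<longleftrightarrow> (\<exists>f\<in>a. \<exists>g\<in>b. AE w in M. f w \<le> g w)"

text \<open>The scalar field $K$ is rendered by the sort
  \<open>{real_normed_field, euclidean_space}\<close>: it contains \<^typ>\<open>real\<close> and \<^typ>\<open>complex\<close>, and every field of
  this sort is isometrically isomorphic to one of the two (a finite-dimensional real field with
  multiplicative norm).\<close>

definition L0_ring :: "'w measure \<Rightarrow> ('w \<Rightarrow> 'k::{real_normed_field, euclidean_space}) set ring" where
  "L0_ring M = \<lparr>carrier = L0 M, mult = L0_map2 M (*), one = L0_const M 1,
                zero = L0_const M 0, add = L0_map2 M (+)\<rparr>"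

definition L0_plus :: "'w measure \<Rightarrow> ('w \<Rightarrow> real) set set" where
  "L0_plus M = {a \<in> L0 M. L0_le M (L0_const M 0) a}"

definition L0bar :: "'w measure \<Rightarrow> ('w \<Rightarrow> ereal) set gorder" where
  "L0bar M = \<lparr>carrier = L0 M, eq = (=), le = L0_le M\<rparr>"

lemma equiv_ae_rel: "equiv (borel_measurable M) (ae_rel M)"
  by (rule equivI) (auto simp: ae_rel_def refl_on_def sym_def trans_def elim: eventually_elim2)

lemma L0_cases:
  assumes "a \<in> L0 M"
  obtains f where "f \<in> borel_measurable M" "a = ae_rel M `` {f}"
  using assms unfolding L0_def quotient_def by auto

lemma ae_class_eq_iff:
  assumes "f \<in> borel_measurable M" "g \<in> borel_measurable M"
  shows "ae_rel M `` {f} = ae_rel M `` {g} \<longleftrightarrow> (AE w in M. f w = g w)"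
  using eq_equiv_class_iff[OF equiv_ae_rel assms] assms by (simp add: ae_rel_def)

lemma L0_map2_class:
  assumes f: "f \<in> borel_measurable M" and g: "g \<in> borel_measurable M"
    and h: "\<And>f g. f \<in> borel_measurable M \<Longrightarrow> g \<in> borel_measurable M \<Longrightarrow>
      (\<lambda>w. h (f w) (g w)) \<in> borel_measurable M"
  shows "L0_map2 M h (ae_rel M `` {f}) (ae_rel M `` {g}) = ae_rel M `` {\<lambda>w. h (f w) (g w)}"
proof -
  have "ae_rel M `` {\<lambda>w. h (f' w) (g' w)} = ae_rel M `` {\<lambda>w. h (f w) (g w)}"
    if "f' \<in> ae_rel M `` {f}" "g' \<in> ae_rel M `` {g}" for f' g'
    using that by (subst ae_class_eq_iff) (auto simp: ae_rel_def intro!: h)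
  moreover have "f \<in> ae_rel M `` {f}" "g \<in> ae_rel M `` {g}"
    using f g by (auto simp: ae_rel_def)
  ultimately show ?thesis unfolding L0_map2_def by blast
qed

lemma ae_class_in_L0: "f \<in> borel_measurable M \<Longrightarrow> ae_rel M `` {f} \<in> L0 M"
  by (auto simp: L0_def intro: quotientI)

lemma L0_add_class: "f \<in> borel_measurable M \<Longrightarrow> g \<in> borel_measurable M \<Longrightarrow>
    ae_rel M `` {f} \<oplus>\<^bsub>L0_ring M\<^esub> ae_rel M `` {g} = ae_rel M `` {\<lambda>w. f w + g w}"
  by (simp add: L0_ring_def) (rule L0_map2_class, simp_all)

lemma L0_mult_class: "f \<in> borel_measurable M \<Longrightarrow> g \<in> borel_measurable M \<Longrightarrow>
    ae_rel M `` {f} \<otimes>\<^bsub>L0_ring M\<^esub> ae_rel M `` {g} = ae_rel M `` {\<lambda>w. f w * g w}"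
  by (simp add: L0_ring_def) (rule L0_map2_class, simp_all)

lemma L0_zero_class: "\<zero>\<^bsub>L0_ring M\<^esub> = ae_rel M `` {\<lambda>_. 0}"
  and L0_one_class: "\<one>\<^bsub>L0_ring M\<^esub> = ae_rel M `` {\<lambda>_. 1}"
  by (simp_all add: L0_ring_def L0_const_def)

lemma carrier_L0_ring: "carrier (L0_ring M) = L0 M"
  by (simp add: L0_ring_def)

lemma cring_L0_ring: "cring (L0_ring M)"
proof -
  note cls = L0_add_class L0_mult_class L0_zero_class L0_one_class carrier_L0_ring ae_class_in_L0
  have ag: "abelian_group (L0_ring M)"
  proof (rule abelian_groupI, goal_cases)
    case (1 x y) then show ?case by (auto simp: cls elim!: L0_cases)
  next
    case 2 show ?case by (simp add: cls)
  next
    case (3 x y z) then show ?case unfolding carrier_L0_ring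
      by (elim L0_cases) (simp add: cls add.assoc)
  next
    case (4 x y) then show ?case unfolding carrier_L0_ring
      by (elim L0_cases) (simp add: cls add.commute)
  next
    case (5 x) then show ?case unfolding carrier_L0_ring
      by (elim L0_cases) (simp add: cls)
  next
    case (6 x)
    then obtain f where "f \<in> borel_measurable M" "x = ae_rel M `` {f}"
      unfolding carrier_L0_ring by (rule L0_cases)
    then show ?case
      by (intro bexI[of _ "ae_rel M `` {\<lambda>w. - f w}"]) (simp_all add: cls)
  qed
  have cm: "comm_monoid (L0_ring M)"
  proof (rule comm_monoidI, goal_cases)
    case (1 x y) then show ?case by (auto simp: cls elim!: L0_cases)
  next
    case 2 show ?case by (simp add: cls)
  next
    case (3 x y z) then show ?case unfolding carrier_L0_ring
      by (elim L0_cases) (simp add: cls mult.assoc)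
  next
    case (4 x) then show ?case unfolding carrier_L0_ring
      by (elim L0_cases) (simp add: cls)
  next
    case (5 x y) then show ?case unfolding carrier_L0_ring
      by (elim L0_cases) (simp add: cls mult.commute)
  qed
  show ?thesis
  proof (rule cringI[OF ag cm], goal_cases)
    case (1 x y z) then show ?case unfolding carrier_L0_ring
      by (elim L0_cases) (simp add: cls distrib_right)
  qed
qed

abbreviation L0_ereal :: "'w measure \<Rightarrow> ('w \<Rightarrow> real) set \<Rightarrow> ('w \<Rightarrow> ereal) set" where
  "L0_ereal M \<equiv> L0_map M ereal"


section \<open>Random normed modules\<close>

record ('w, 'k, 'x) rn_struct = "(('w \<Rightarrow> 'k) set, 'x) module" +
  L0norm :: "'x \<Rightarrow> ('w \<Rightarrow> real) set"

locale rn_module = prob_space M + module "L0_ring M" X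
  for M :: "'w measure" and X :: "('w, 'k::{real_normed_field, euclidean_space}, 'x) rn_struct" +
  assumes L0norm_in: "x \<in> carrier X \<Longrightarrow> L0norm X x \<in> L0_plus M"
    and L0norm_smult: "\<xi> \<in> L0 M \<Longrightarrow> x \<in> carrier X \<Longrightarrow>
      L0norm X (\<xi> \<odot>\<^bsub>X\<^esub> x) = L0_map M norm \<xi> \<otimes>\<^bsub>L0_ring M\<^esub> L0norm X x"
    and L0norm_triangle: "x \<in> carrier X \<Longrightarrow> y \<in> carrier X \<Longrightarrow>
      L0_le M (L0norm X (x \<oplus>\<^bsub>X\<^esub> y)) (L0norm X x \<oplus>\<^bsub>L0_ring M\<^esub> L0norm X y)"
    and L0norm_eq_zero: "x \<in> carrier X \<Longrightarrow> L0norm X x = \<zero>\<^bsub>L0_ring M\<^esub> \<Longrightarrow> x = \<zero>\<^bsub>X\<^esub>"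

definition rn_nbhd :: "'w measure \<Rightarrow> ('w, 'k::real_normed_field, 'x) rn_struct \<Rightarrow> real \<Rightarrow> real \<Rightarrow> 'x set" where
  "rn_nbhd M X \<epsilon> l = {z \<in> carrier X. \<exists>f\<in>L0norm X z. measure M {w \<in> space M. f w < \<epsilon>} > l}"

definition rn_topology :: "'w measure \<Rightarrow> ('w, 'k::real_normed_field, 'x) rn_struct \<Rightarrow> 'x topology" where
  "rn_topology M X = topology (\<lambda>U. U \<subseteq> carrier X \<and>
     (\<forall>x\<in>U. \<exists>\<epsilon>>0. \<exists>l\<in>{0<..<1}. \<forall>y\<in>carrier X. y \<ominus>\<^bsub>X\<^esub> x \<in> rn_nbhd M X \<epsilon> l \<longrightarrow> y \<in> U))"

lemma (in rn_module) rn_nbhd_mono: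
  assumes "\<epsilon> \<le> \<epsilon>'" "l' \<le> l"
  shows "rn_nbhd M X \<epsilon> l \<subseteq> rn_nbhd M X \<epsilon>' l'"
proof
  fix z assume "z \<in> rn_nbhd M X \<epsilon> l"
  then obtain f where z: "z \<in> carrier X" and f: "f \<in> L0norm X z" "l < prob {w \<in> space M. f w < \<epsilon>}"
    by (auto simp: rn_nbhd_def)
  have "L0norm X z \<in> L0 M"
    using L0norm_in[OF z] by (simp add: L0_plus_def)
  then have "f \<in> borel_measurable M"
    using f(1) by (auto elim!: L0_cases simp: ae_rel_def)
  then have "prob {w \<in> space M. f w < \<epsilon>} \<le> prob {w \<in> space M. f w < \<epsilon>'}"
    using assms by (intro finite_measure_mono) auto
  with z f assms show "z \<in> rn_nbhd M X \<epsilon>' l'"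
    by (auto simp: rn_nbhd_def intro!: bexI[of _ f])
qed

lemma (in rn_module) openin_rn_topology:
  "openin (rn_topology M X) U \<longleftrightarrow> U \<subseteq> carrier X \<and>
     (\<forall>x\<in>U. \<exists>\<epsilon>>0. \<exists>l\<in>{0<..<1}. \<forall>y\<in>carrier X. y \<ominus>\<^bsub>X\<^esub> x \<in> rn_nbhd M X \<epsilon> l \<longrightarrow> y \<in> U)"
proof -
  let ?N = "\<lambda>U x. \<exists>\<epsilon>>0. \<exists>l\<in>{0<..<1}. \<forall>y\<in>carrier X. y \<ominus>\<^bsub>X\<^esub> x \<in> rn_nbhd M X \<epsilon> l \<longrightarrow> y \<in> U"
  have inter: "?N (S \<inter> T) x" if "?N S x" "?N T x" for S T x
  proof -
    from that obtain e1 l1 e2 l2 where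
      "e1 > 0" "l1 \<in> {0<..<1}" "e2 > 0" "l2 \<in> {0<..<1}"
      "\<forall>y\<in>carrier X. y \<ominus>\<^bsub>X\<^esub> x \<in> rn_nbhd M X e1 l1 \<longrightarrow> y \<in> S"
      "\<forall>y\<in>carrier X. y \<ominus>\<^bsub>X\<^esub> x \<in> rn_nbhd M X e2 l2 \<longrightarrow> y \<in> T"
      by metis
    then show ?thesis
      using rn_nbhd_mono[of "min e1 e2" e1 l1 "max l1 l2"] rn_nbhd_mono[of "min e1 e2" e2 l2 "max l1 l2"]
      by (intro exI[of _ "min e1 e2"] conjI bexI[of _ "max l1 l2"] ballI impI) auto
  qed
  have union: "?N (\<Union>K) x" if "U \<in> K" "?N U x" for K U x
    using that by (meson UnionI)
  have "istopology (\<lambda>U. U \<subseteq> carrier X \<and> (\<forall>x\<in>U. ?N U x))"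
    unfolding istopology_def
  proof (intro conjI allI impI)
    fix S T assume "S \<subseteq> carrier X \<and> (\<forall>x\<in>S. ?N S x)" "T \<subseteq> carrier X \<and> (\<forall>x\<in>T. ?N T x)"
    then show "S \<inter> T \<subseteq> carrier X" "\<forall>x\<in>S \<inter> T. ?N (S \<inter> T) x"
      using inter by blast+
  next
    fix K assume K: "\<forall>S\<in>K. S \<subseteq> carrier X \<and> (\<forall>x\<in>S. ?N S x)"
    then show "\<Union>K \<subseteq> carrier X" by blast
    show "\<forall>x\<in>\<Union>K. ?N (\<Union>K) x"
    proof
      fix x assume "x \<in> \<Union>K"
      then obtain U where U: "U \<in> K" "x \<in> U" by blast
      then have "?N U x" using K by blast
      with U(1) show "?N (\<Union>K) x" by (rule union)
    qed
  qed
  then show ?thesis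
    unfolding rn_topology_def by (rule topology_inverse'[THEN fun_cong])
qed

text \<open>The topology is metrizable by a translation-invariant metric, so completeness is sequential.\<close>

definition rn_complete :: "'w measure \<Rightarrow> ('w, 'k::real_normed_field, 'x) rn_struct \<Rightarrow> bool" where
  "rn_complete M X \<longleftrightarrow> (\<forall>x. range x \<subseteq> carrier X \<and>
     (\<forall>\<epsilon>>0. \<forall>l\<in>{0<..<1}. \<exists>N::nat. \<forall>m\<ge>N. \<forall>n\<ge>N. x m \<ominus>\<^bsub>X\<^esub> x n \<in> rn_nbhd M X \<epsilon> l)
     \<longrightarrow> (\<exists>y. limitin (rn_topology M X) x y sequentially))"

definition rn_continuous :: "'w measure \<Rightarrow> ('w, 'k::real_normed_field, 'x) rn_struct \<Rightarrow> (real \<Rightarrow> 'x) \<Rightarrow> bool" where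
  "rn_continuous M X F \<longleftrightarrow> continuous_map (top_of_set {0..}) (rn_topology M X) F"

text \<open>The derivative at \<open>s \<ge> 0\<close> of a function on \<open>{0..}\<close>; it is one-sided at \<open>s = 0\<close>.\<close>

definition rn_has_deriv :: "'w measure \<Rightarrow> ('w, 'k::real_normed_field, 'x) rn_struct \<Rightarrow>
    (real \<Rightarrow> 'x) \<Rightarrow> 'x \<Rightarrow> real \<Rightarrow> bool" where
  "rn_has_deriv M X F d s \<longleftrightarrow>
     limitin (rn_topology M X)
       (\<lambda>t. L0_const M (of_real (1 / (t - s))) \<odot>\<^bsub>X\<^esub> (F t \<ominus>\<^bsub>X\<^esub> F s)) d (at s within {0..})"

definition riemann_sum :: "'w measure \<Rightarrow> ('w, 'k::real_normed_field, 'x) rn_struct \<Rightarrow>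
    (real \<Rightarrow> 'x) \<Rightarrow> (real \<times> real set) set \<Rightarrow> 'x" where
  "riemann_sum M X F p = finsum X (\<lambda>(t, J). L0_const M (of_real (measure lborel J)) \<odot>\<^bsub>X\<^esub> F t) p"

text \<open>Tagged partitions of \<open>{a..b}\<close> as the mesh tends to \<open>0\<close>.\<close>

definition mesh_filter :: "real \<Rightarrow> real \<Rightarrow> (real \<times> real set) set filter" where
  "mesh_filter a b = (INF \<delta>\<in>{0<..}. principal
     {p. p tagged_division_of {a..b} \<and> (\<forall>(t, J)\<in>p. measure lborel J < \<delta>)})"

definition rn_has_integral :: "'w measure \<Rightarrow> ('w, 'k::real_normed_field, 'x) rn_struct \<Rightarrow>
    (real \<Rightarrow> 'x) \<Rightarrow> 'x \<Rightarrow> real \<Rightarrow> real \<Rightarrow> bool" where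
  "rn_has_integral M X F I a b \<longleftrightarrow> limitin (rn_topology M X) (riemann_sum M X F) I (mesh_filter a b)"

definition rn_uniform_null :: "'w measure \<Rightarrow> ('w, 'k::real_normed_field, 'x) rn_struct \<Rightarrow>
    (nat \<Rightarrow> real \<Rightarrow> 'x) \<Rightarrow> real set \<Rightarrow> bool" where
  "rn_uniform_null M X F S \<longleftrightarrow>
     (\<forall>\<epsilon>>0. \<forall>l\<in>{0<..<1}. \<forall>\<^sub>F n in sequentially. \<forall>s\<in>S. F n s \<in> rn_nbhd M X \<epsilon> l)"


section \<open>Operators\<close>

definition module_homs :: "('w \<Rightarrow> 'k::{real_normed_field, euclidean_space}) set ring \<Rightarrow>
    ('w, 'k, 'x) rn_struct \<Rightarrow> ('w, 'k, 'y) rn_struct \<Rightarrow> ('x \<Rightarrow> 'y) set" where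
  "module_homs R X Y = {T \<in> carrier X \<rightarrow> carrier Y.
     (\<forall>x\<in>carrier X. \<forall>y\<in>carrier X. T (x \<oplus>\<^bsub>X\<^esub> y) = T x \<oplus>\<^bsub>Y\<^esub> T y) \<and>
     (\<forall>\<xi>\<in>carrier R. \<forall>x\<in>carrier X. T (\<xi> \<odot>\<^bsub>X\<^esub> x) = \<xi> \<odot>\<^bsub>Y\<^esub> T x)}"

definition as_bounds :: "'w measure \<Rightarrow> ('w, 'k, 'x) rn_struct \<Rightarrow> ('w, 'k, 'y) rn_struct \<Rightarrow>
    ('x \<Rightarrow> 'y) \<Rightarrow> ('w \<Rightarrow> real) set set" where
  "as_bounds M X Y T = {\<eta> \<in> L0_plus M. \<forall>z\<in>carrier X.
     L0_le M (L0norm Y (T z)) (\<eta> \<otimes>\<^bsub>L0_ring M\<^esub> L0norm X z)}"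

text \<open>The a.s. bounded operators $B(X,Y)$; linearity is over $K$, embedded as the constant classes.\<close>

definition rn_B :: "'w measure \<Rightarrow> ('w, 'k::real_normed_field, 'x) rn_struct \<Rightarrow>
    ('w, 'k, 'y) rn_struct \<Rightarrow> ('x \<Rightarrow> 'y) set" where
  "rn_B M X Y = {T \<in> carrier X \<rightarrow> carrier Y.
     (\<forall>x\<in>carrier X. \<forall>y\<in>carrier X. T (x \<oplus>\<^bsub>X\<^esub> y) = T x \<oplus>\<^bsub>Y\<^esub> T y) \<and>
     (\<forall>c. \<forall>x\<in>carrier X. T (L0_const M c \<odot>\<^bsub>X\<^esub> x) = L0_const M c \<odot>\<^bsub>Y\<^esub> T x) \<and>
     as_bounds M X Y T \<noteq> {}}"

definition op_L0norm :: "'w measure \<Rightarrow> ('w, 'k, 'x) rn_struct \<Rightarrow> ('w, 'k, 'y) rn_struct \<Rightarrow>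
    ('x \<Rightarrow> 'y) \<Rightarrow> ('w \<Rightarrow> ereal) set" where
  "op_L0norm M X Y T = \<Sqinter>\<^bsub>L0bar M\<^esub> (L0_ereal M ` as_bounds M X Y T)"

definition locally_as_bounded :: "'w measure \<Rightarrow> ('w, 'k, 'x) rn_struct \<Rightarrow> (real \<Rightarrow> 'x \<Rightarrow> 'x) \<Rightarrow> bool" where
  "locally_as_bounded M X V \<longleftrightarrow>
     (\<forall>l>0. \<Squnion>\<^bsub>L0bar M\<^esub> ((\<lambda>s. op_L0norm M X X (V s)) ` {0..l}) \<in> L0_ereal M ` L0_plus M)"

definition graph_module :: "'w measure \<Rightarrow> ('w, 'k, 'x) rn_struct \<Rightarrow> 'x set \<Rightarrow> ('x \<Rightarrow> 'x) \<Rightarrow>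
    ('w, 'k, 'x) rn_struct" where
  "graph_module M X D A =
     X\<lparr>carrier := D, L0norm := \<lambda>z. L0norm X z \<oplus>\<^bsub>L0_ring M\<^esub> L0norm X (A z)\<rparr>"


section \<open>Existence families and the abstract Cauchy problem\<close>

definition mild_existence_family :: "'w measure \<Rightarrow> ('w, 'k::real_normed_field, 'x) rn_struct \<Rightarrow>
    'x set \<Rightarrow> ('x \<Rightarrow> 'x) \<Rightarrow> ('x \<Rightarrow> 'x) \<Rightarrow> (real \<Rightarrow> 'x \<Rightarrow> 'x) \<Rightarrow> bool" where
  "mild_existence_family M X D A C V \<longleftrightarrow>
     (\<forall>s\<ge>0. V s \<in> rn_B M X X) \<and> locally_as_bounded M X V \<and>
     (\<forall>z\<in>carrier X. rn_continuous M X (\<lambda>s. V s z)) \<and>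
     (\<forall>z\<in>carrier X. \<forall>s\<ge>0. \<exists>I\<in>D. rn_has_integral M X (\<lambda>u. V u z) I 0 s \<and> A I = V s z \<ominus>\<^bsub>X\<^esub> C z)"

definition existence_family :: "'w measure \<Rightarrow> ('w, 'k::real_normed_field, 'x) rn_struct \<Rightarrow>
    'x set \<Rightarrow> ('x \<Rightarrow> 'x) \<Rightarrow> ('x \<Rightarrow> 'x) \<Rightarrow> (real \<Rightarrow> 'x \<Rightarrow> 'x) \<Rightarrow> bool" where
  "existence_family M X D A C V \<longleftrightarrow>
     (\<forall>s\<ge>0. V s \<in> rn_B M (graph_module M X D A) (graph_module M X D A)) \<and>
     locally_as_bounded M (graph_module M X D A) V \<and>
     (\<forall>z\<in>D. rn_continuous M (graph_module M X D A) (\<lambda>s. V s z)) \<and>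
     (\<forall>z\<in>D. \<forall>s\<ge>0. rn_has_integral M X (\<lambda>u. A (V u z)) (V s z \<ominus>\<^bsub>X\<^esub> C z) 0 s)"

definition acp_solution :: "'w measure \<Rightarrow> ('w, 'k::real_normed_field, 'x) rn_struct \<Rightarrow>
    'x set \<Rightarrow> ('x \<Rightarrow> 'x) \<Rightarrow> 'x \<Rightarrow> (real \<Rightarrow> 'x) \<Rightarrow> bool" where
  "acp_solution M X D A z W \<longleftrightarrow>
     rn_continuous M (graph_module M X D A) W \<and>
     (\<exists>W'. (\<forall>s\<ge>0. rn_has_deriv M X W (W' s) s) \<and> rn_continuous M X W' \<and>
           (\<forall>s>0. W' s = A (W s))) \<and>
     W 0 = z"

definition acp_mild_solution :: "'w measure \<Rightarrow> ('w, 'k::real_normed_field, 'x) rn_struct \<Rightarrow>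
    'x set \<Rightarrow> ('x \<Rightarrow> 'x) \<Rightarrow> 'x \<Rightarrow> (real \<Rightarrow> 'x) \<Rightarrow> bool" where
  "acp_mild_solution M X D A z W \<longleftrightarrow>
     rn_continuous M X W \<and>
     (\<forall>s\<ge>0. \<Squnion>\<^bsub>L0bar M\<^esub> ((\<lambda>u. L0_ereal M (L0norm X (W u))) ` {0..s}) \<in> L0_ereal M ` L0_plus M) \<and>
     (\<forall>s\<ge>0. \<exists>I\<in>D. rn_has_integral M X W I 0 s \<and> W s = A I \<oplus>\<^bsub>X\<^esub> z)"

end

theory Submission
  imports Defs
begin

text \<open>The random norms of \<open>V(s) z\<close>, \<open>s \<in> [0, l]\<close>, are dominated a.s. by \<open>K \<parallel>z\<parallel>\<close> with a single
  random variable \<open>K\<close>; discarding the event \<open>K > N\<close> turns convergence in probability of \<open>z\<^sub>n\<close> into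
  uniform convergence in probability of \<open>V(s) z\<^sub>n\<close>. For (b) the same argument is run in the graph
  module, and the only analytic point is that the integral of \<open>A V(\<cdot>) z\<close> is differentiable. The
  topology is metrized by \<open>E min(1, \<parallel>x - y\<parallel>)\<close>, which is not convex in \<open>x\<close>, but off the event where the
  local a.s. bound of the integrand exceeds \<open>N\<close> the functions \<open>min(1, r)\<close> and \<open>r\<close> differ at most by the
  factor \<open>N\<close>. So mean values over short intervals are close to the value of the integrand, although the
  module is not locally convex.\<close>

section \<open>Essential suprema\<close>

text \<open>The dominating \<open>K\<close> cannot be formed as a pointwise supremum: s runs through
  an uncountable set, and every inequality between norms holds only off a null set that depends on s
  and z. It has to come from the lattice of extended random variables, where a supremum is already
  reached along a countable subfamily. The lattice operations are Hilbert choices of a least upper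
  or greatest lower bound, so existence of these bounds must be established before the definition of
  local a.s. boundedness can be used at all.

  Part (b) mixes two modules: continuity and boundedness are given in the graph norm, the integral
  identity in X. The link is that \<open>A\<close> is continuous from the graph module to X and that
  the norm of A x is dominated by the graph norm of x. This supplies both the continuity and the
  local a.s. bound of the integrand which differentiation in X needs.\<close>

lemma L0_le_class:
  assumes "f \<in> borel_measurable M" "g \<in> borel_measurable M"
  shows "L0_le M (ae_rel M `` {f}) (ae_rel M `` {g}) \<longleftrightarrow> (AE w in M. f w \<le> g w)"
proof
  assume "L0_le M (ae_rel M `` {f}) (ae_rel M `` {g})"
  then obtain f' g' where "AE w in M. f w = f' w" "AE w in M. g w = g' w" "AE w in M. f' w \<le> g' w"
    by (auto simp: L0_le_def ae_rel_def)
  then show "AE w in M. f w \<le> g w"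
    by eventually_elim simp
next
  assume "AE w in M. f w \<le> g w"
  then show "L0_le M (ae_rel M `` {f}) (ae_rel M `` {g})"
    using assms unfolding L0_le_def
    by (intro bexI[of _ f] bexI[of _ g]) (auto simp: ae_rel_def)
qed

lemma L0_map_class:
  assumes f: "f \<in> borel_measurable M"
    and h: "\<And>f. f \<in> borel_measurable M \<Longrightarrow> (\<lambda>w. h (f w)) \<in> borel_measurable M"
  shows "L0_map M h (ae_rel M `` {f}) = ae_rel M `` {\<lambda>w. h (f w)}"
proof -
  have "ae_rel M `` {\<lambda>w. h (f' w)} = ae_rel M `` {\<lambda>w. h (f w)}" if "f' \<in> ae_rel M `` {f}" for f'
    using that by (subst ae_class_eq_iff) (auto simp: ae_rel_def intro!: h)
  moreover have "f \<in> ae_rel M `` {f}"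
    using f by (auto simp: ae_rel_def)
  ultimately show ?thesis unfolding L0_map_def by blast
qed

lemma L0_ereal_class:
  "f \<in> borel_measurable M \<Longrightarrow> L0_ereal M (ae_rel M `` {f}) = ae_rel M `` {\<lambda>w. ereal (f w)}"
  by (rule L0_map_class) simp_all

lemma L0_ereal_in: "a \<in> L0 M \<Longrightarrow> L0_ereal M a \<in> L0 M"
  by (elim L0_cases) (simp add: L0_ereal_class ae_class_in_L0)

text \<open>A representative is nonnegative only a.s.; replacing it by its positive part changes it
  on a null set and makes it nonnegative everywhere.\<close>

lemma L0_plus_cases:
  assumes "a \<in> L0_plus M"
  obtains f where "f \<in> borel_measurable M" "\<And>w. 0 \<le> f w" "a = ae_rel M `` {f}"
proof -
  from assms obtain g where g: "g \<in> borel_measurable M" "a = ae_rel M `` {g}"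
    by (auto simp: L0_plus_def elim: L0_cases)
  with assms have "AE w in M. 0 \<le> g w"
    by (auto simp: L0_plus_def L0_const_def L0_le_class)
  then have "a = ae_rel M `` {\<lambda>w. max 0 (g w)}"
    using g by (auto simp: ae_class_eq_iff)
  then show thesis
    using g by (intro that[of "\<lambda>w. max 0 (g w)"]) auto
qed

lemma L0_plus_class:
  assumes "f \<in> borel_measurable M" "AE w in M. 0 \<le> f w"
  shows "ae_rel M `` {f} \<in> L0_plus M"
  using assms by (simp add: L0_plus_def L0_const_def L0_le_class ae_class_in_L0)

text \<open>A bounded, strictly increasing Borel map on the extended reals. Boundedness gives every
  supremum a finite expectation after composition; strictness lets equal expectations of ordered
  suprema force their a.s. equality.\<close>

definition arctan_ereal :: "ereal \<Rightarrow> real" where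
  "arctan_ereal x = (if x = \<infinity> then pi / 2 else if x = -\<infinity> then - pi / 2 else arctan (real_of_ereal x))"

lemma arctan_ereal_mono: "x < y \<Longrightarrow> arctan_ereal x < arctan_ereal y"
  using arctan_bounded
  by (cases x; cases y) (auto simp: arctan_ereal_def arctan_less_iff intro: order.strict_trans)

lemma arctan_ereal_le_iff: "arctan_ereal x \<le> arctan_ereal y \<longleftrightarrow> x \<le> y"
  by (metis arctan_ereal_mono leD linorder_le_less_linear order_le_less)

lemma abs_arctan_ereal_le: "\<bar>arctan_ereal x\<bar> \<le> pi / 2"
  using arctan_bounded[of "real_of_ereal x"] by (auto simp: arctan_ereal_def abs_le_iff)

lemma measurable_arctan_ereal [measurable]: "arctan_ereal \<in> borel_measurable borel"
  unfolding arctan_ereal_def by measurable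

lemma SUP_range_mono:
  fixes x y :: "nat \<Rightarrow> 'b \<Rightarrow> ereal"
  assumes "range x \<subseteq> range y"
  shows "(SUP n. x n w) \<le> (SUP n. y n w)"
proof (rule SUP_mono)
  fix n
  have "x n \<in> range y" using assms by blast
  then show "\<exists>m\<in>UNIV. x n w \<le> y m w" by auto
qed

context prob_space
begin

text \<open>A countable subfamily maximizing the expectation of a bounded increasing function of its
  supremum already dominates the whole family.\<close>

lemma ess_sup_sequence_exists:
  fixes F :: "('a \<Rightarrow> ereal) set"
  assumes F: "F \<subseteq> borel_measurable M" "F \<noteq> {}"
  shows "\<exists>x :: nat \<Rightarrow> 'a \<Rightarrow> ereal. range x \<subseteq> F \<and> (\<forall>f\<in>F. AE w in M. f w \<le> (SUP n. x n w))"
proof -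
  define J where "J x = (\<integral>w. arctan_ereal (SUP n. x n w) \<partial>M)" for x :: "nat \<Rightarrow> 'a \<Rightarrow> ereal"
  have meas: "(\<lambda>w. arctan_ereal (SUP n. x n w)) \<in> borel_measurable M"
    if "range x \<subseteq> F" for x :: "nat \<Rightarrow> 'a \<Rightarrow> ereal"
  proof -
    have [measurable]: "x n \<in> borel_measurable M" for n
      using that F by blast
    show ?thesis by measurable
  qed
  have int: "integrable M (\<lambda>w. arctan_ereal (SUP n. x n w))"
    if "range x \<subseteq> F" for x :: "nat \<Rightarrow> 'a \<Rightarrow> ereal"
    using meas[OF that] abs_arctan_ereal_le by (intro integrable_const_bound[where B = "pi / 2"]) auto
  have J_le: "J x \<le> pi / 2" if "range x \<subseteq> F" for x
  proof -
    have "J x \<le> (\<integral>w. pi / 2 \<partial>M)"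
      unfolding J_def
      using abs_le_D1[OF abs_arctan_ereal_le] by (intro integral_mono int that) simp_all
    then show ?thesis by (simp add: prob_space)
  qed
  have J_mono: "J x \<le> J y" if "range x \<subseteq> F" "range y \<subseteq> F" "range x \<subseteq> range y" for x y
    unfolding J_def using that(3)
    by (intro integral_mono int that) (auto simp: arctan_ereal_le_iff intro: SUP_range_mono)
  define S where "S = {J x | x. range x \<subseteq> F}"
  obtain f0 where "f0 \<in> F" using F by blast
  then have "J (\<lambda>_. f0) \<in> S" by (auto simp: S_def)
  then have S: "S \<noteq> {}" "bdd_above S"
    using J_le by (auto simp: S_def intro!: bdd_aboveI[of _ "pi / 2"])
  have "\<exists>x :: nat \<Rightarrow> 'a \<Rightarrow> ereal. range x \<subseteq> F \<and> Sup S - 1 / Suc k < J x" for k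
  proof -
    have "Sup S - 1 / Suc k < Sup S" by simp
    then obtain v where "v \<in> S" "Sup S - 1 / Suc k < v"
      using less_cSup_iff[OF S] by blast
    then show ?thesis
      unfolding S_def by blast
  qed
  then obtain x where x: "\<And>k. range (x k) \<subseteq> F" "\<And>k. Sup S - 1 / Suc k < J (x k)"
    by metis
  \<comment> \<open>One enumeration of all terms of all the sequences \<open>x k\<close>, so that
    each of their ranges lies in the range of \<open>y\<close>.\<close>
  define y where "y n = x (fst (prod_decode n)) (snd (prod_decode n))" for n
  have y: "range y \<subseteq> F"
    using x(1) by (auto simp: y_def)
  have xy: "range (x k) \<subseteq> range y" for k
  proof
    fix g assume "g \<in> range (x k)"
    then obtain n where "g = x k n" by auto
    then have "g = y (prod_encode (k, n))" by (simp add: y_def)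
    then show "g \<in> range y" by blast
  qed
  have "Sup S \<le> J y"
  proof (rule field_le_epsilon)
    fix e :: real assume "0 < e"
    then obtain k where k: "1 / Suc k < e" by (metis nat_approx_posE)
    have "J (x k) \<le> J y" by (rule J_mono[OF x(1) y xy])
    with x(2)[of k] k show "Sup S \<le> J y + e" by linarith
  qed
  show ?thesis
  proof (intro exI[of _ y] conjI y ballI)
    fix f assume f: "f \<in> F"
    \<comment> \<open>Prepending \<open>f\<close> to \<open>y\<close> cannot raise \<open>J\<close>
      above \<open>Sup S\<close>; the two ordered suprema then have equal expectation and agree
      a.s.\<close>
    define z where "z = case_nat f y"
    have z: "range z \<subseteq> F"
      using f y by (auto simp: z_def image_subset_iff split: nat.splits)
    have yz: "range y \<subseteq> range z"
    proof
      fix g assume "g \<in> range y"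
      then obtain n where "g = z (Suc n)" by (auto simp: z_def)
      then show "g \<in> range z" by blast
    qed
    have "J z \<in> S" using z by (auto simp: S_def)
    then have "J z \<le> Sup S" using S by (simp add: cSup_upper)
    then have "J z \<le> J y" using \<open>Sup S \<le> J y\<close> by linarith
    then have eq: "J z = J y" using J_mono[OF y z yz] by simp
    have "AE w in M. arctan_ereal (SUP n. y n w) = arctan_ereal (SUP n. z n w)"
    proof (rule integral_ineq_eq_0_then_AE)
      show "AE w in M. arctan_ereal (SUP n. y n w) \<le> arctan_ereal (SUP n. z n w)"
        using yz by (intro AE_I2) (auto simp: arctan_ereal_le_iff intro: SUP_range_mono)
    qed (use int y z eq in \<open>auto simp: J_def\<close>)
    then show "AE w in M. f w \<le> (SUP n. y n w)"
    proof eventually_elim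
      case (elim w)
      then have "(SUP n. z n w) \<le> (SUP n. y n w)"
        by (simp flip: arctan_ereal_le_iff)
      moreover have "f w \<le> (SUP n. z n w)"
        by (rule SUP_upper2[of 0]) (auto simp: z_def)
      ultimately show ?case by simp
    qed
  qed
qed

section \<open>Suprema and infima of classes of extended random variables\<close>

lemma L0bar_Sup_exists:
  assumes "S \<subseteq> L0 M"
  shows "\<exists>b. least (L0bar M) b (Upper (L0bar M) S)"
proof (cases "S = {}")
  case True
  have "L0_le M (ae_rel M `` {\<lambda>_. - \<infinity>}) b" if "b \<in> L0 M" for b :: "('a \<Rightarrow> ereal) set"
    using that by (auto elim!: L0_cases simp: L0_le_class)
  then show ?thesis
    using True
    by (intro exI[of _ "ae_rel M `` {\<lambda>_. - \<infinity>}"])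
       (auto simp: least_def Upper_def L0bar_def ae_class_in_L0)
next
  case False
  \<comment> \<open>All representatives of all classes in \<open>S\<close>: the countable selection
    works with functions, and the pointwise supremum of the selected sequence is measurable.\<close>
  define F where "F = {f \<in> borel_measurable M. ae_rel M `` {f} \<in> S}"
  have cover: "\<exists>f\<in>F. a = ae_rel M `` {f}" if "a \<in> S" for a
  proof -
    have "a \<in> L0 M" using assms that by blast
    then obtain f where "f \<in> borel_measurable M" "a = ae_rel M `` {f}"
      by (rule L0_cases)
    then show ?thesis using that by (auto simp: F_def)
  qed
  then have F: "F \<noteq> {}" using False by blast
  have Fm: "F \<subseteq> borel_measurable M" by (auto simp: F_def)
  obtain x :: "nat \<Rightarrow> 'a \<Rightarrow> ereal"
    where "range x \<subseteq> F \<and> (\<forall>f\<in>F. AE w in M. f w \<le> (SUP n. x n w))"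
    using ess_sup_sequence_exists[OF Fm F] ..
  then have x: "range x \<subseteq> F"
    and ub: "\<And>f. f \<in> F \<Longrightarrow> AE w in M. f w \<le> (SUP n. x n w)"
    by auto
  have [measurable]: "x n \<in> borel_measurable M" for n
    using x by (auto simp: F_def)
  have g: "(\<lambda>w. SUP n. x n w) \<in> borel_measurable M"
    by measurable
  have "L0_le M a (ae_rel M `` {\<lambda>w. SUP n. x n w})" if "a \<in> S" for a
    using cover[OF that] ub g by (auto simp: F_def L0_le_class)
  moreover have "L0_le M (ae_rel M `` {\<lambda>w. SUP n. x n w}) b"
    if "b \<in> L0 M" "\<And>a. a \<in> S \<Longrightarrow> L0_le M a b" for b
  proof -
    obtain h where h: "h \<in> borel_measurable M" "b = ae_rel M `` {h}"
      using \<open>b \<in> L0 M\<close> by (rule L0_cases)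
    have "AE w in M. x n w \<le> h w" for n
      using that(2)[of "ae_rel M `` {x n}"] x h by (auto simp: F_def L0_le_class)
    then have "AE w in M. \<forall>n. x n w \<le> h w"
      by (simp add: AE_all_countable)
    then have "AE w in M. (SUP n. x n w) \<le> h w"
      by eventually_elim (auto intro: SUP_least)
    then show ?thesis
      using h g by (simp add: L0_le_class)
  qed
  ultimately show ?thesis
    using assms g
    by (intro exI[of _ "ae_rel M `` {\<lambda>w. SUP n. x n w}"])
       (auto simp: least_def Upper_def L0bar_def ae_class_in_L0)
qed

text \<open>The supremum is by definition some least upper bound picked by choice, so existence of
  one transfers its properties to the chosen one.\<close>

lemma L0bar_Sup_least:
  "S \<subseteq> L0 M \<Longrightarrow> least (L0bar M) (\<Squnion>\<^bsub>L0bar M\<^esub> S) (Upper (L0bar M) S)"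
  unfolding sup_def using L0bar_Sup_exists by (rule someI_ex)

lemma L0bar_Sup_in: "S \<subseteq> L0 M \<Longrightarrow> \<Squnion>\<^bsub>L0bar M\<^esub> S \<in> L0 M"
  and L0bar_Sup_upper: "S \<subseteq> L0 M \<Longrightarrow> a \<in> S \<Longrightarrow> L0_le M a (\<Squnion>\<^bsub>L0bar M\<^esub> S)"
  and L0bar_Sup_le: "S \<subseteq> L0 M \<Longrightarrow> b \<in> L0 M \<Longrightarrow> (\<And>a. a \<in> S \<Longrightarrow> L0_le M a b) \<Longrightarrow>
    L0_le M (\<Squnion>\<^bsub>L0bar M\<^esub> S) b"
  using L0bar_Sup_least[of S] by (auto simp: least_def Upper_def L0bar_def subset_iff)

text \<open>The supremum of all lower bounds is the greatest lower bound, so no second exhaustion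
  argument is run.\<close>

lemma L0bar_Inf_greatest:
  assumes "S \<subseteq> L0 M"
  shows "greatest (L0bar M) (\<Sqinter>\<^bsub>L0bar M\<^esub> S) (Lower (L0bar M) S)"
proof -
  let ?L = "Lower (L0bar M) S"
  have L: "?L \<subseteq> L0 M" by (auto simp: Lower_def L0bar_def)
  have "L0_le M (\<Squnion>\<^bsub>L0bar M\<^esub> ?L) a" if "a \<in> S" for a
    using that assms by (intro L0bar_Sup_le L) (auto simp: Lower_def L0bar_def)
  then have "greatest (L0bar M) (\<Squnion>\<^bsub>L0bar M\<^esub> ?L) ?L"
    using L L0bar_Sup_in[OF L] L0bar_Sup_upper[OF L]
    by (auto simp: greatest_def Lower_def L0bar_def)
  then show ?thesis
    unfolding inf_def by (rule someI)
qed

lemma L0bar_Inf_in: "S \<subseteq> L0 M \<Longrightarrow> \<Sqinter>\<^bsub>L0bar M\<^esub> S \<in> L0 M"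
  and L0bar_Inf_ge: "S \<subseteq> L0 M \<Longrightarrow> b \<in> L0 M \<Longrightarrow> (\<And>a. a \<in> S \<Longrightarrow> L0_le M b a) \<Longrightarrow>
    L0_le M b (\<Sqinter>\<^bsub>L0bar M\<^esub> S)"
  using L0bar_Inf_greatest[of S] by (auto simp: greatest_def Lower_def L0bar_def subset_iff)

end

section \<open>The metric of convergence in probability\<close>

lemma L0_const_in: "L0_const M c \<in> L0 M"
  by (simp add: L0_const_def ae_class_in_L0)

lemma L0_const_add: "L0_const M a \<oplus>\<^bsub>L0_ring M\<^esub> L0_const M b = L0_const M (a + b)"
  by (simp add: L0_const_def L0_add_class)

lemma L0_const_mult: "L0_const M a \<otimes>\<^bsub>L0_ring M\<^esub> L0_const M b = L0_const M (a * b)"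
  by (simp add: L0_const_def L0_mult_class)

lemma L0_const_0: "L0_const M 0 = \<zero>\<^bsub>L0_ring M\<^esub>"
  and L0_const_1: "L0_const M 1 = \<one>\<^bsub>L0_ring M\<^esub>"
  by (simp_all add: L0_ring_def)

section \<open>Multiplication by constants, the norm as a function, and the metric\<close>

context rn_module
begin

text \<open>The constant classes make X a vector space over the field; difference quotients and
  Riemann sums use only such scalars.\<close>

abbreviation cmult :: "'k \<Rightarrow> 'x \<Rightarrow> 'x" where
  "cmult c x \<equiv> L0_const M c \<odot>\<^bsub>X\<^esub> x"

lemma cmult_closed [simp]: "x \<in> carrier X \<Longrightarrow> cmult c x \<in> carrier X"
  by (simp add: carrier_L0_ring L0_const_in)

lemma cmult_add_left: "x \<in> carrier X \<Longrightarrow> cmult (a + b) x = cmult a x \<oplus>\<^bsub>X\<^esub> cmult b x"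
  by (simp add: carrier_L0_ring L0_const_in smult_l_distr flip: L0_const_add)

lemma cmult_add_right:
  "x \<in> carrier X \<Longrightarrow> y \<in> carrier X \<Longrightarrow> cmult a (x \<oplus>\<^bsub>X\<^esub> y) = cmult a x \<oplus>\<^bsub>X\<^esub> cmult a y"
  by (simp add: carrier_L0_ring L0_const_in smult_r_distr)

lemma cmult_cmult: "x \<in> carrier X \<Longrightarrow> cmult a (cmult b x) = cmult (a * b) x"
  by (simp add: carrier_L0_ring L0_const_in smult_assoc1 flip: L0_const_mult)

lemma cmult_zero_left: "x \<in> carrier X \<Longrightarrow> cmult 0 x = \<zero>\<^bsub>X\<^esub>"
  by (simp add: L0_const_0)

lemma cmult_one: "x \<in> carrier X \<Longrightarrow> cmult 1 x = x"
  by (simp add: L0_const_1)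

text \<open>Negation as a scalar multiple yields the norm of a negative, the compatibility of
  \<open>A\<close> with negation, and the agreement of negation in X and in the graph
  module.\<close>

lemma cmult_minus_one: "x \<in> carrier X \<Longrightarrow> cmult (-1) x = \<ominus>\<^bsub>X\<^esub> x"
  using cmult_add_left[of x "-1" 1]
  by (intro M.minus_equality[symmetric]) (simp_all add: cmult_one cmult_zero_left)

lemma cmult_diff_right:
  assumes "x \<in> carrier X" "y \<in> carrier X"
  shows "cmult a (x \<ominus>\<^bsub>X\<^esub> y) = cmult a x \<ominus>\<^bsub>X\<^esub> cmult a y"
proof -
  have "cmult a (\<ominus>\<^bsub>X\<^esub> y) = \<ominus>\<^bsub>X\<^esub> cmult a y"
    using assms by (simp add: cmult_cmult flip: cmult_minus_one)
  then show ?thesis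
    using assms by (simp add: a_minus_def cmult_add_right)
qed

lemma minus_add_minus_cancel:
  assumes "x \<in> carrier X" "y \<in> carrier X" "z \<in> carrier X"
  shows "(x \<ominus>\<^bsub>X\<^esub> y) \<oplus>\<^bsub>X\<^esub> (y \<ominus>\<^bsub>X\<^esub> z) = x \<ominus>\<^bsub>X\<^esub> z"
  using assms by (simp add: a_minus_def M.a_assoc M.r_neg1)

lemma minus_eq_zero_iff:
  assumes "x \<in> carrier X" "y \<in> carrier X"
  shows "x \<ominus>\<^bsub>X\<^esub> y = \<zero>\<^bsub>X\<^esub> \<longleftrightarrow> x = y"
proof
  assume "x \<ominus>\<^bsub>X\<^esub> y = \<zero>\<^bsub>X\<^esub>"
  then have "\<ominus>\<^bsub>X\<^esub> (\<ominus>\<^bsub>X\<^esub> y) = x"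
    using assms by (intro M.minus_equality) (simp_all add: a_minus_def)
  then show "x = y" using assms by simp
qed (use assms in \<open>simp add: a_minus_def M.r_neg\<close>)

text \<open>Fixing one representative, nonnegative everywhere on the carrier, turns relations
  between classes into a.s. relations between functions.\<close>

definition rnorm :: "'x \<Rightarrow> 'w \<Rightarrow> real" where
  "rnorm x = (SOME f. f \<in> borel_measurable M \<and> (\<forall>w. 0 \<le> f w) \<and> L0norm X x = ae_rel M `` {f})"

lemma
  assumes "x \<in> carrier X"
  shows measurable_rnorm [measurable]: "rnorm x \<in> borel_measurable M"
    and rnorm_nonneg: "0 \<le> rnorm x w"
    and L0norm_eq: "L0norm X x = ae_rel M `` {rnorm x}"
proof -
  have "\<exists>f. f \<in> borel_measurable M \<and> (\<forall>w. 0 \<le> f w) \<and> L0norm X x = ae_rel M `` {f}"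
    using L0norm_in[OF assms] by (elim L0_plus_cases) auto
  from someI_ex[OF this] show "rnorm x \<in> borel_measurable M" "0 \<le> rnorm x w"
    "L0norm X x = ae_rel M `` {rnorm x}"
    unfolding rnorm_def by auto
qed

lemma rnorm_add:
  assumes "x \<in> carrier X" "y \<in> carrier X"
  shows "AE w in M. rnorm (x \<oplus>\<^bsub>X\<^esub> y) w \<le> rnorm x w + rnorm y w"
  using L0norm_triangle[OF assms] assms
  by (simp add: L0norm_eq L0_add_class measurable_rnorm L0_le_class)

lemma rnorm_cmult:
  assumes "x \<in> carrier X"
  shows "AE w in M. rnorm (cmult c x) w = norm c * rnorm x w"
proof -
  have "L0_map M norm (L0_const M c) = ae_rel M `` {\<lambda>_. norm c}"
    unfolding L0_const_def by (rule L0_map_class) simp_all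
  then have "ae_rel M `` {rnorm (cmult c x)} = ae_rel M `` {\<lambda>w. norm c * rnorm x w}"
    using L0norm_smult[OF L0_const_in assms, of c] assms
    by (simp add: L0norm_eq L0_mult_class measurable_rnorm)
  then show ?thesis
    using assms by (subst (asm) ae_class_eq_iff) (simp_all add: measurable_rnorm)
qed

lemma rnorm_minus: "x \<in> carrier X \<Longrightarrow> AE w in M. rnorm (\<ominus>\<^bsub>X\<^esub> x) w = rnorm x w"
  using rnorm_cmult[of x "-1"] by (simp add: cmult_minus_one)

lemma rnorm_zero: "AE w in M. rnorm \<zero>\<^bsub>X\<^esub> w = 0"
  using rnorm_cmult[of "\<zero>\<^bsub>X\<^esub>" 0] by (simp add: cmult_zero_left)

lemma rnorm_diff:
  assumes "x \<in> carrier X" "y \<in> carrier X"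
  shows "AE w in M. rnorm (x \<ominus>\<^bsub>X\<^esub> y) w \<le> rnorm x w + rnorm y w"
proof -
  have "AE w in M. rnorm (x \<ominus>\<^bsub>X\<^esub> y) w \<le> rnorm x w + rnorm (\<ominus>\<^bsub>X\<^esub> y) w"
    unfolding a_minus_def using assms by (intro rnorm_add) simp_all
  with rnorm_minus[OF assms(2)] show ?thesis
    by eventually_elim simp
qed

lemma rnorm_eq_zero:
  assumes "x \<in> carrier X" "AE w in M. rnorm x w = 0"
  shows "x = \<zero>\<^bsub>X\<^esub>"
  using assms by (intro L0norm_eq_zero)
    (simp_all add: L0norm_eq L0_zero_class ae_class_eq_iff measurable_rnorm)

definition pnorm :: "'x \<Rightarrow> real" where
  "pnorm x = (\<integral>w. min 1 (rnorm x w) \<partial>M)"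

lemma integrable_min_rnorm:
  assumes "x \<in> carrier X"
  shows "integrable M (\<lambda>w. min 1 (rnorm x w))"
  using assms rnorm_nonneg[OF assms]
  by (intro integrable_const_bound[where B = 1]) (auto simp: measurable_rnorm)

lemma pnorm_nonneg: "x \<in> carrier X \<Longrightarrow> 0 \<le> pnorm x"
  unfolding pnorm_def by (intro integral_nonneg_AE) (simp add: rnorm_nonneg)

text \<open>Truncation at 1 destroys homogeneity; what survives is min 1 (c r) \<le> max 1 c * min 1
  r for r \<ge> 0.\<close>

lemma pnorm_le_scaled:
  assumes "x \<in> carrier X" "y \<in> carrier X" "AE w in M. rnorm x w \<le> c * rnorm y w"
  shows "pnorm x \<le> max 1 c * pnorm y"
proof -
  have "pnorm x \<le> (\<integral>w. max 1 c * min 1 (rnorm y w) \<partial>M)"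
    unfolding pnorm_def
  proof (rule integral_mono_AE)
    show "AE w in M. min 1 (rnorm x w) \<le> max 1 c * min 1 (rnorm y w)"
      using assms(3)
    proof eventually_elim
      case (elim w)
      have "c * rnorm y w \<le> max 1 c * rnorm y w"
        using rnorm_nonneg[OF assms(2), of w] by (simp add: mult_right_mono)
      with elim show ?case by (auto simp: min_def)
    qed
  qed (use assms integrable_min_rnorm in auto)
  then show ?thesis by (simp add: pnorm_def)
qed

lemma pnorm_eqI:
  assumes "x \<in> carrier X" "y \<in> carrier X" "AE w in M. rnorm x w = rnorm y w"
  shows "pnorm x = pnorm y"
  unfolding pnorm_def using assms by (intro integral_cong_AE) (auto simp: measurable_rnorm)

lemma pnorm_minus: "x \<in> carrier X \<Longrightarrow> pnorm (\<ominus>\<^bsub>X\<^esub> x) = pnorm x"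
  by (intro pnorm_eqI rnorm_minus) simp_all

lemma pnorm_cmult: "x \<in> carrier X \<Longrightarrow> pnorm (cmult c x) \<le> max 1 (norm c) * pnorm x"
  by (rule pnorm_le_scaled) (use rnorm_cmult[of x c] in auto)

lemma pnorm_add:
  assumes "x \<in> carrier X" "y \<in> carrier X"
  shows "pnorm (x \<oplus>\<^bsub>X\<^esub> y) \<le> pnorm x + pnorm y"
proof -
  have "pnorm (x \<oplus>\<^bsub>X\<^esub> y) \<le> (\<integral>w. min 1 (rnorm x w) + min 1 (rnorm y w) \<partial>M)"
    unfolding pnorm_def
  proof (rule integral_mono_AE)
    show "AE w in M. min 1 (rnorm (x \<oplus>\<^bsub>X\<^esub> y) w) \<le> min 1 (rnorm x w) + min 1 (rnorm y w)"
      using rnorm_add[OF assms]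
      by eventually_elim
        (use rnorm_nonneg[OF assms(1)] rnorm_nonneg[OF assms(2)] in \<open>smt (verit) min_def\<close>)
  qed (use assms integrable_min_rnorm in auto)
  then show ?thesis
    using assms by (simp add: pnorm_def integrable_min_rnorm)
qed

lemma pnorm_eq_0_iff:
  assumes "x \<in> carrier X"
  shows "pnorm x = 0 \<longleftrightarrow> x = \<zero>\<^bsub>X\<^esub>"
proof
  assume "pnorm x = 0"
  then have "AE w in M. min 1 (rnorm x w) = 0"
    using integral_nonneg_eq_0_iff_AE[OF integrable_min_rnorm[OF assms]] rnorm_nonneg[OF assms]
    by (simp add: pnorm_def)
  then have "AE w in M. rnorm x w = 0"
    by eventually_elim (simp add: min_def split: if_splits)
  then show "x = \<zero>\<^bsub>X\<^esub>"
    by (rule rnorm_eq_zero[OF assms])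
next
  assume "x = \<zero>\<^bsub>X\<^esub>"
  have "AE w in M. min 1 (rnorm \<zero>\<^bsub>X\<^esub> w) = 0"
    using rnorm_zero by eventually_elim simp
  then show "pnorm x = 0"
    unfolding pnorm_def \<open>x = \<zero>\<^bsub>X\<^esub>\<close> by (rule integral_eq_zero_AE)
qed

text \<open>The definition quantifies over representatives of the norm, but any two agree a.s. and
  give the event the same probability.\<close>

lemma rn_nbhd_iff:
  assumes "x \<in> carrier X"
  shows "x \<in> rn_nbhd M X \<epsilon> l \<longleftrightarrow> prob {w \<in> space M. rnorm x w < \<epsilon>} > l"
proof -
  have eq: "prob {w \<in> space M. f w < \<epsilon>} = prob {w \<in> space M. rnorm x w < \<epsilon>}" if "f \<in> L0norm X x" for f
  proof (rule finite_measure_eq_AE)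
    have ae: "AE w in M. rnorm x w = f w" and f: "f \<in> borel_measurable M"
      using that by (simp_all add: L0norm_eq[OF assms] ae_rel_def)
    show "AE w in M. w \<in> {w \<in> space M. f w < \<epsilon>} \<longleftrightarrow> w \<in> {w \<in> space M. rnorm x w < \<epsilon>}"
      using ae by eventually_elim simp
    show "{w \<in> space M. f w < \<epsilon>} \<in> events"
      using f by auto
    show "{w \<in> space M. rnorm x w < \<epsilon>} \<in> events"
      using measurable_rnorm[OF assms] by auto
  qed
  have "rnorm x \<in> L0norm X x"
    using assms by (auto simp: L0norm_eq ae_rel_def measurable_rnorm)
  then have "x \<in> rn_nbhd M X \<epsilon> l" if "prob {w \<in> space M. rnorm x w < \<epsilon>} > l"
    using that assms unfolding rn_nbhd_def by blast
  moreover have "prob {w \<in> space M. rnorm x w < \<epsilon>} > l" if nb: "x \<in> rn_nbhd M X \<epsilon> l"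
  proof -
    from nb obtain f where f: "f \<in> L0norm X x" "prob {w \<in> space M. f w < \<epsilon>} > l"
      unfolding rn_nbhd_def by blast
    show ?thesis
      using f(2) unfolding eq[OF f(1)] .
  qed
  ultimately show ?thesis by blast
qed

text \<open>Markov's inequality: off the event the truncated norm is at least min 1 \<epsilon>, so
  min 1 \<epsilon> times the probability of the complement is at most
  \<open>pnorm x\<close>.\<close>

lemma rn_nbhdI:
  assumes "x \<in> carrier X" "0 < \<epsilon>" "pnorm x < min 1 \<epsilon> * (1 - l)"
  shows "x \<in> rn_nbhd M X \<epsilon> l"
proof -
  let ?A = "{w \<in> space M. rnorm x w < \<epsilon>}"
  have A: "?A \<in> events"
    using measurable_rnorm[OF assms(1)] by auto
  then have intA: "integrable M (indicator ?A :: 'w \<Rightarrow> real)"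
    by (intro integrable_real_indicator) (simp_all add: emeasure_eq_measure)
  have "(\<integral>w. min 1 \<epsilon> \<partial>M) \<le> (\<integral>w. min 1 (rnorm x w) + min 1 \<epsilon> * indicator ?A w \<partial>M)"
  proof (rule integral_mono)
    show "integrable M (\<lambda>w. min 1 (rnorm x w) + min 1 \<epsilon> * indicator ?A w)"
      using intA integrable_min_rnorm[OF assms(1)] by simp
    show "min 1 \<epsilon> \<le> min 1 (rnorm x w) + min 1 \<epsilon> * indicator ?A w" if "w \<in> space M" for w
      using that \<open>0 < \<epsilon>\<close> rnorm_nonneg[OF assms(1), of w] by (auto simp: min_def indicator_def not_less)
  qed simp
  also have "\<dots> = pnorm x + min 1 \<epsilon> * prob ?A"
    using intA A assms(1) by (simp add: integrable_min_rnorm pnorm_def)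
  finally have "min 1 \<epsilon> \<le> pnorm x + min 1 \<epsilon> * prob ?A"
    by (simp add: prob_space)
  with assms(3) have "min 1 \<epsilon> * l < min 1 \<epsilon> * prob ?A"
    by (simp add: right_diff_distrib)
  then show ?thesis
    using assms(1,2) by (simp add: rn_nbhd_iff mult_less_cancel_left_pos)
qed

text \<open>The truncated norm is below \<epsilon> on the event and at most 1 on its complement,
  whose probability is less than 1 - l.\<close>

lemma pnorm_less_if_rn_nbhd:
  assumes "x \<in> rn_nbhd M X \<epsilon> l" "0 < \<epsilon>"
  shows "pnorm x < \<epsilon> + 1 - l"
proof -
  have x: "x \<in> carrier X"
    using assms by (simp add: rn_nbhd_def)
  let ?A = "{w \<in> space M. rnorm x w < \<epsilon>}"
  have A: "?A \<in> events"
    using measurable_rnorm[OF x] by auto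
  then have intA: "integrable M (indicator ?A :: 'w \<Rightarrow> real)"
    by (intro integrable_real_indicator) (simp_all add: emeasure_eq_measure)
  have l: "l < prob ?A"
    using assms x by (simp add: rn_nbhd_iff)
  have "pnorm x \<le> (\<integral>w. \<epsilon> + 1 - indicator ?A w \<partial>M)"
    unfolding pnorm_def
  proof (rule integral_mono)
    show "integrable M (\<lambda>w. \<epsilon> + 1 - indicator ?A w)"
      using intA by simp
    show "min 1 (rnorm x w) \<le> \<epsilon> + 1 - indicator ?A w" if "w \<in> space M" for w
      using that \<open>0 < \<epsilon>\<close> by (auto simp: indicator_def)
  qed (rule integrable_min_rnorm[OF x])
  also have "\<dots> = \<epsilon> + 1 - prob ?A"
    using intA A by (simp add: prob_space)
  finally show ?thesis using l by simp
qed

text \<open>The default 0 off the carrier is there because \<open>Metric_space\<close> demands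
  nonnegativity and symmetry on the whole type.\<close>

definition pdist :: "'x \<Rightarrow> 'x \<Rightarrow> real" where
  "pdist x y = (if x \<in> carrier X \<and> y \<in> carrier X then pnorm (x \<ominus>\<^bsub>X\<^esub> y) else 0)"

lemma Metric_space_pdist: "Metric_space (carrier X) pdist"
proof
  show "0 \<le> pdist x y" for x y
    by (simp add: pdist_def pnorm_nonneg)
  show "pdist x y = pdist y x" for x y
  proof -
    have "\<ominus>\<^bsub>X\<^esub> (x \<ominus>\<^bsub>X\<^esub> y) = y \<ominus>\<^bsub>X\<^esub> x" if "x \<in> carrier X" "y \<in> carrier X"
      using that by (simp add: a_minus_def M.minus_add M.a_comm)
    then show ?thesis
      using pnorm_minus[of "x \<ominus>\<^bsub>X\<^esub> y"] by (auto simp: pdist_def)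
  qed
  show "pdist x y = 0 \<longleftrightarrow> x = y" if "x \<in> carrier X" "y \<in> carrier X" for x y
    using that by (simp add: pdist_def pnorm_eq_0_iff minus_eq_zero_iff)
  show "pdist x z \<le> pdist x y + pdist y z"
    if "x \<in> carrier X" "y \<in> carrier X" "z \<in> carrier X" for x y z
    using that pnorm_add[of "x \<ominus>\<^bsub>X\<^esub> y" "y \<ominus>\<^bsub>X\<^esub> z"]
    by (simp add: pdist_def minus_add_minus_cancel)
qed

lemma mtopology_pdist: "Metric_space.mtopology (carrier X) pdist = rn_topology M X"
proof -
  interpret P: Metric_space "carrier X" pdist by (rule Metric_space_pdist)
  have ball_subset: "\<exists>\<epsilon>>0. \<exists>l\<in>{0<..<1}. \<forall>y\<in>carrier X. y \<ominus>\<^bsub>X\<^esub> x \<in> rn_nbhd M X \<epsilon> l \<longrightarrow> y \<in> P.mball x r"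
    if "0 < r" "x \<in> carrier X" for x r
  \<comment> \<open>With these parameters \<epsilon> + 1 - l equals min 1 r, the bound wanted for
    \<open>pnorm\<close>; the minimum with 1 keeps l inside (0, 1).\<close>
  proof (intro exI[of _ "min 1 r / 2"] conjI bexI[of _ "1 - min 1 r / 2"] ballI impI)
    fix y assume y: "y \<in> carrier X" "y \<ominus>\<^bsub>X\<^esub> x \<in> rn_nbhd M X (min 1 r / 2) (1 - min 1 r / 2)"
    then have "pnorm (y \<ominus>\<^bsub>X\<^esub> x) < min 1 r"
      using pnorm_less_if_rn_nbhd[OF y(2)] that by simp
    then show "y \<in> P.mball x r"
      using y(1) that(2) by (simp add: P.commute[of x y]) (simp add: pdist_def)
  qed (use that in auto)
  have nbhd_subset: "\<exists>r>0. \<forall>y\<in>P.mball x r. y \<ominus>\<^bsub>X\<^esub> x \<in> rn_nbhd M X \<epsilon> l"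
    if "0 < \<epsilon>" "l \<in> {0<..<1}" "x \<in> carrier X" for \<epsilon> l x
  \<comment> \<open>The radius is the threshold in Markov's inequality above.\<close>
  proof (intro exI[of _ "min 1 \<epsilon> * (1 - l)"] conjI ballI)
    fix y assume "y \<in> P.mball x (min 1 \<epsilon> * (1 - l))"
    then have "y \<in> carrier X" "pnorm (y \<ominus>\<^bsub>X\<^esub> x) < min 1 \<epsilon> * (1 - l)"
      using that(3) P.commute[of x y] by (auto simp: pdist_def)
    then show "y \<ominus>\<^bsub>X\<^esub> x \<in> rn_nbhd M X \<epsilon> l"
      using that by (intro rn_nbhdI) auto
  qed (use that in auto)
  show ?thesis
    unfolding topology_eq P.openin_mtopology openin_rn_topology
  proof (intro allI conj_cong refl)
    fix U assume U: "U \<subseteq> carrier X"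
    show "(\<forall>x. x \<in> U \<longrightarrow> (\<exists>r>0. P.mball x r \<subseteq> U)) \<longleftrightarrow>
      (\<forall>x\<in>U. \<exists>\<epsilon>>0. \<exists>l\<in>{0<..<1}. \<forall>y\<in>carrier X. y \<ominus>\<^bsub>X\<^esub> x \<in> rn_nbhd M X \<epsilon> l \<longrightarrow> y \<in> U)"
    proof (intro iffI ballI allI impI)
      fix x assume *: "\<forall>x. x \<in> U \<longrightarrow> (\<exists>r>0. P.mball x r \<subseteq> U)" and x: "x \<in> U"
      then obtain r where "0 < r" "P.mball x r \<subseteq> U" by blast
      with ball_subset[of r x] x U
      show "\<exists>\<epsilon>>0. \<exists>l\<in>{0<..<1}. \<forall>y\<in>carrier X. y \<ominus>\<^bsub>X\<^esub> x \<in> rn_nbhd M X \<epsilon> l \<longrightarrow> y \<in> U"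
        by (meson subsetD)
    next
      fix x assume *: "\<forall>x\<in>U. \<exists>\<epsilon>>0. \<exists>l\<in>{0<..<1}. \<forall>y\<in>carrier X. y \<ominus>\<^bsub>X\<^esub> x \<in> rn_nbhd M X \<epsilon> l \<longrightarrow> y \<in> U"
        and x: "x \<in> U"
      then obtain \<epsilon> l where el: "0 < \<epsilon>" "l \<in> {0<..<1}"
        and sub: "\<And>y. y \<in> carrier X \<Longrightarrow> y \<ominus>\<^bsub>X\<^esub> x \<in> rn_nbhd M X \<epsilon> l \<Longrightarrow> y \<in> U"
        by blast
      have "x \<in> carrier X" using x U by blast
      from nbhd_subset[OF el this] obtain r where "0 < r"
        and "\<And>y. y \<in> P.mball x r \<Longrightarrow> y \<ominus>\<^bsub>X\<^esub> x \<in> rn_nbhd M X \<epsilon> l"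
        by blast
      then show "\<exists>r>0. P.mball x r \<subseteq> U"
        using sub by (intro exI[of _ r]) (auto simp del: P.in_mball dest: P.mball_subset_mspace[THEN subsetD])
    qed
  qed
qed

lemma limitin_rn_topology:
  "limitin (rn_topology M X) f x F \<longleftrightarrow>
     x \<in> carrier X \<and> (\<forall>\<^sub>F a in F. f a \<in> carrier X) \<and> ((\<lambda>a. pdist (f a) x) \<longlongrightarrow> 0) F"
  using Metric_space.limitin_metric_dist_null[OF Metric_space_pdist]
  by (simp add: mtopology_pdist)

lemma limitin_rn_topology_unique:
  assumes "limitin (rn_topology M X) f x F" "limitin (rn_topology M X) f y F" "F \<noteq> bot"
  shows "x = y"
  using Metric_space.limitin_metric_unique[OF Metric_space_pdist] assms
  by (simp add: mtopology_pdist)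

lemma topspace_rn_topology: "topspace (rn_topology M X) = carrier X"
  using Metric_space.topspace_mtopology[OF Metric_space_pdist] by (simp add: mtopology_pdist)

end

section \<open>Bounds for operators\<close>

lemma L0_le_trans:
  assumes "a \<in> L0 M" "b \<in> L0 M" "c \<in> L0 M" "L0_le M a b" "L0_le M b c"
  shows "L0_le M a c"
proof -
  obtain f g h where "f \<in> borel_measurable M" "a = ae_rel M `` {f}"
    "g \<in> borel_measurable M" "b = ae_rel M `` {g}"
    "h \<in> borel_measurable M" "c = ae_rel M `` {h}"
    using assms(1-3) by (elim L0_cases)
  note fgh = this
  with assms(4,5) have "AE w in M. f w \<le> g w" "AE w in M. g w \<le> h w"
    by (simp_all add: L0_le_class)
  then have "AE w in M. f w \<le> h w"
    by eventually_elim simp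
  with fgh show ?thesis by (simp add: L0_le_class)
qed

text \<open>Continuity from above: the events decrease to the empty set because \<open>K\<close> is
  real-valued. The condition 1 \<le> N is what the truncation estimates ask for.\<close>

lemma (in prob_space) prob_greater_tendsto_0:
  fixes K :: "'a \<Rightarrow> real"
  assumes [measurable]: "K \<in> borel_measurable M" and "0 < e"
  obtains N :: real where "1 \<le> N" "prob {w \<in> space M. N < K w} < e"
proof -
  have "(\<lambda>n. prob {w \<in> space M. real n < K w}) \<longlonglongrightarrow> prob (\<Inter>n. {w \<in> space M. real n < K w})"
    by (rule finite_Lim_measure_decseq) (auto simp: decseq_def)
  also have "(\<Inter>n. {w \<in> space M. real n < K w}) = {}"
    by auto (meson less_asym reals_Archimedean2)
  finally have "\<forall>\<^sub>F n in sequentially. prob {w \<in> space M. real n < K w} < e"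
    using \<open>0 < e\<close> by (auto dest: order_tendstoD(2))
  then have "\<forall>\<^sub>F n in sequentially. prob {w \<in> space M. real n < K w} < e \<and> 1 \<le> n"
    using eventually_ge_at_top by (rule eventually_conj)
  then obtain n where "prob {w \<in> space M. real n < K w} < e" "1 \<le> n"
    by (auto simp: eventually_sequentially)
  then show thesis
    by (intro that[of "real n"]) auto
qed

context rn_module
begin

lemma diff_zero: "x \<in> carrier X \<Longrightarrow> x \<ominus>\<^bsub>X\<^esub> \<zero>\<^bsub>X\<^esub> = x"
  using M.minus_equality[of "\<zero>\<^bsub>X\<^esub>" "\<zero>\<^bsub>X\<^esub>"] by (simp add: a_minus_def)

lemma as_bounds_subset: "as_bounds M X X T \<subseteq> L0_plus M"
  by (auto simp: as_bounds_def)

lemma L0_ereal_as_bounds: "L0_ereal M ` as_bounds M X X T \<subseteq> L0 M"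
  by (auto simp: as_bounds_def L0_plus_def L0_ereal_in)

lemma op_L0norm_in: "op_L0norm M X X T \<in> L0 M"
  unfolding op_L0norm_def using L0_ereal_as_bounds by (rule L0bar_Inf_in)

text \<open>The quotient of the norms of \<open>T z\<close> and \<open>z\<close> is a lower bound of all a.s. bounds of \<open>T\<close>, so
  there is no need to know that the infimum of the a.s. bounds is itself an a.s. bound.\<close>

lemma rnorm_le_if_op_L0norm_le:
  assumes T: "T \<in> rn_B M X X" and z: "z \<in> carrier X"
    and h: "h \<in> borel_measurable M" "L0_le M (op_L0norm M X X T) (ae_rel M `` {\<lambda>w. ereal (h w)})"
  shows "AE w in M. rnorm (T z) w \<le> h w * rnorm z w"
proof -
  have Tz: "T z \<in> carrier X"
    using T z by (auto simp: rn_B_def)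
  have [measurable]: "rnorm z \<in> borel_measurable M" "rnorm (T z) \<in> borel_measurable M"
    using z Tz by (simp_all add: measurable_rnorm)
  have bound: "AE w in M. rnorm (T z) w \<le> f w * rnorm z w"
    if "ae_rel M `` {f} \<in> as_bounds M X X T" "f \<in> borel_measurable M" for f
  proof -
    have "L0_le M (L0norm X (T z)) (ae_rel M `` {f} \<otimes>\<^bsub>L0_ring M\<^esub> L0norm X z)"
      using that(1) z by (auto simp: as_bounds_def)
    then show ?thesis
      using that(2) by (simp add: L0norm_eq[OF z] L0norm_eq[OF Tz] L0_mult_class L0_le_class)
  qed
  \<comment> \<open>The value -\<infinity> on the zero set of \<open>rnorm z\<close> keeps
    \<open>q\<close> below every a.s. bound there.\<close>
  define q where "q w = (if 0 < rnorm z w then ereal (rnorm (T z) w / rnorm z w) else - \<infinity>)" for w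
  have q [measurable]: "q \<in> borel_measurable M"
    unfolding q_def by measurable
  have "L0_le M (ae_rel M `` {q}) (op_L0norm M X X T)"
    unfolding op_L0norm_def
  proof (rule L0bar_Inf_ge[OF L0_ereal_as_bounds ae_class_in_L0[OF q]])
    fix a assume "a \<in> L0_ereal M ` as_bounds M X X T"
    then obtain \<eta> where eta: "\<eta> \<in> as_bounds M X X T" "a = L0_ereal M \<eta>" by blast
    then have "\<eta> \<in> L0_plus M" using as_bounds_subset by blast
    then obtain f where f: "f \<in> borel_measurable M" "\<eta> = ae_rel M `` {f}"
      by (rule L0_plus_cases)
    have "AE w in M. q w \<le> ereal (f w)"
      using bound[of f] eta f
      by (auto elim!: eventually_mono simp: q_def divide_le_eq)
    then show "L0_le M (ae_rel M `` {q}) a"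
      using f eta q by (simp add: L0_ereal_class L0_le_class)
  qed
  then have "L0_le M (ae_rel M `` {q}) (ae_rel M `` {\<lambda>w. ereal (h w)})"
    using h op_L0norm_in q by (blast intro: L0_le_trans ae_class_in_L0 borel_measurable_ereal)
  then have qh: "AE w in M. q w \<le> ereal (h w)"
    using h q by (simp add: L0_le_class)
  \<comment> \<open>Where \<open>rnorm z\<close> vanishes the quotient carries no information; one
    arbitrary a.s. bound of \<open>T\<close> gives \<open>rnorm (T z) w = 0\<close> there.\<close>
  obtain \<eta> where "\<eta> \<in> as_bounds M X X T"
    using T by (auto simp: rn_B_def)
  moreover from this have "\<eta> \<in> L0_plus M" using as_bounds_subset by blast
  ultimately obtain f where "AE w in M. rnorm (T z) w \<le> f w * rnorm z w"
    using bound by (metis L0_plus_cases)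
  with qh show ?thesis
  proof eventually_elim
    case (elim w)
    show ?case
    proof (cases "0 < rnorm z w")
      case True
      with elim(1) show ?thesis by (simp add: q_def divide_le_eq)
    next
      case False
      then have "rnorm z w = 0" using rnorm_nonneg[OF z, of w] by simp
      with elim(2) show ?thesis by simp
    qed
  qed
qed

text \<open>\<open>K\<close> represents the lattice supremum of the operator norms over [0, l]. It
  is chosen before s and z; only the exceptional null set depends on them.\<close>

lemma locally_as_bounded_bound:
  assumes V: "\<And>s. 0 \<le> s \<Longrightarrow> V s \<in> rn_B M X X" and bdd: "locally_as_bounded M X V" and "0 < l"
  shows "\<exists>K\<in>borel_measurable M. \<forall>s\<in>{0..l}. \<forall>z\<in>carrier X. AE w in M. rnorm (V s z) w \<le> K w * rnorm z w"
proof -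
  let ?S = "(\<lambda>s. op_L0norm M X X (V s)) ` {0..l}"
  have S: "?S \<subseteq> L0 M" using op_L0norm_in by blast
  obtain a where a: "a \<in> L0_plus M" and Sup: "\<Squnion>\<^bsub>L0bar M\<^esub> ?S = L0_ereal M a"
    using bdd \<open>0 < l\<close> unfolding locally_as_bounded_def by blast
  obtain K where K: "K \<in> borel_measurable M" "a = ae_rel M `` {K}"
    using L0_plus_cases[OF a] by blast
  show ?thesis
  proof (intro bexI[OF _ K(1)] ballI)
    fix s z assume s: "s \<in> {0..l}" and z: "z \<in> carrier X"
    have "L0_le M (op_L0norm M X X (V s)) (ae_rel M `` {\<lambda>w. ereal (K w)})"
      using L0bar_Sup_upper[OF S, of "op_L0norm M X X (V s)"] s K by (simp add: Sup L0_ereal_class)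
    then show "AE w in M. rnorm (V s z) w \<le> K w * rnorm z w"
      using V s z K by (intro rnorm_le_if_op_L0norm_le) auto
  qed
qed

text \<open>The supremum is a priori extended-valued. It lies a.s. between one nonnegative member of
  the family and \<open>B\<close>, hence is a.s. finite and nonnegative; an empty family would give
  -\<infinity>.\<close>

lemma Sup_L0norm_in_L0_plus:
  assumes W: "\<And>u. u \<in> S \<Longrightarrow> W u \<in> carrier X" and "S \<noteq> {}" and B: "B \<in> borel_measurable M"
    and le: "\<And>u. u \<in> S \<Longrightarrow> AE w in M. rnorm (W u) w \<le> B w"
  shows "\<Squnion>\<^bsub>L0bar M\<^esub> ((\<lambda>u. L0_ereal M (L0norm X (W u))) ` S) \<in> L0_ereal M ` L0_plus M"
proof -
  have W_eq: "L0_ereal M (L0norm X (W u)) = ae_rel M `` {\<lambda>w. ereal (rnorm (W u) w)}"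
    and W_meas: "(\<lambda>w. ereal (rnorm (W u) w)) \<in> borel_measurable M" if "u \<in> S" for u
    using W[OF that] by (simp_all add: L0norm_eq L0_ereal_class measurable_rnorm)
  let ?S = "(\<lambda>u. L0_ereal M (L0norm X (W u))) ` S"
  have S: "?S \<subseteq> L0 M"
    using W_eq W_meas by (auto intro: ae_class_in_L0)
  obtain g where g: "g \<in> borel_measurable M" and Sup: "\<Squnion>\<^bsub>L0bar M\<^esub> ?S = ae_rel M `` {g}"
    using L0bar_Sup_in[OF S] by (rule L0_cases)
  have "L0_le M (\<Squnion>\<^bsub>L0bar M\<^esub> ?S) (ae_rel M `` {\<lambda>w. ereal (B w)})"
    using le B W_eq W_meas by (intro L0bar_Sup_le[OF S]) (auto simp: L0_le_class intro: ae_class_in_L0)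
  then have gB: "AE w in M. g w \<le> ereal (B w)"
    using g B by (simp add: Sup L0_le_class)
  obtain u where u: "u \<in> S" using \<open>S \<noteq> {}\<close> by blast
  then have "L0_le M (L0_ereal M (L0norm X (W u))) (\<Squnion>\<^bsub>L0bar M\<^esub> ?S)"
    by (intro L0bar_Sup_upper[OF S]) auto
  then have gu: "AE w in M. ereal (rnorm (W u) w) \<le> g w"
    unfolding W_eq[OF u] Sup using g W_meas[OF u] by (simp add: L0_le_class)
  have real_g: "AE w in M. g w = ereal (real_of_ereal (g w)) \<and> 0 \<le> real_of_ereal (g w)"
    using gB gu
  proof eventually_elim
    case (elim w)
    moreover have "0 \<le> rnorm (W u) w" using rnorm_nonneg W u by blast
    ultimately show ?case by (cases "g w") auto
  qed
  then have "ae_rel M `` {g} = L0_ereal M (ae_rel M `` {\<lambda>w. real_of_ereal (g w)})"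
    using g by (simp add: L0_ereal_class ae_class_eq_iff)
  moreover have "ae_rel M `` {\<lambda>w. real_of_ereal (g w)} \<in> L0_plus M"
    using g real_g by (intro L0_plus_class) auto
  ultimately show ?thesis unfolding Sup by blast
qed

text \<open>Truncating at \<open>N\<close>: where the random factor exceeds \<open>N\<close> the integrand is at most \<open>1\<close>,
  elsewhere the factor is at most \<open>N\<close>.\<close>

lemma pnorm_le_truncate:
  assumes x: "x \<in> carrier X" and y: "y \<in> carrier X" and K [measurable]: "K \<in> borel_measurable M"
    and le: "AE w in M. rnorm x w \<le> K w * rnorm y w" and "1 \<le> N"
  shows "pnorm x \<le> prob {w \<in> space M. N < K w} + N * pnorm y"
proof -
  let ?A = "{w \<in> space M. N < K w}"
  have A: "?A \<in> events" by measurable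
  then have intA: "integrable M (indicator ?A :: 'w \<Rightarrow> real)"
    by (intro integrable_real_indicator) (simp_all add: emeasure_eq_measure)
  have "pnorm x \<le> (\<integral>w. indicator ?A w + N * min 1 (rnorm y w) \<partial>M)"
    unfolding pnorm_def
  proof (rule integral_mono_AE)
    show "AE w in M. min 1 (rnorm x w) \<le> indicator ?A w + N * min 1 (rnorm y w)"
      using le AE_space
    proof eventually_elim
      case (elim w)
      have y0: "0 \<le> rnorm y w" by (rule rnorm_nonneg[OF y])
      show ?case
      proof (cases "w \<in> ?A")
        case True
        have "0 \<le> N * min 1 (rnorm y w)" using y0 \<open>1 \<le> N\<close> by simp
        with True show ?thesis by simp
      next
        case False
        with elim have "K w * rnorm y w \<le> N * rnorm y w"
          using y0 by (intro mult_right_mono) auto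
        then have "rnorm x w \<le> N * rnorm y w" using elim by simp
        with False \<open>1 \<le> N\<close> show ?thesis by (auto simp: min_def)
      qed
    qed
  qed (use x y intA integrable_min_rnorm in auto)
  also have "\<dots> = prob ?A + N * pnorm y"
    using A intA y by (simp add: integrable_min_rnorm pnorm_def)
  finally show ?thesis .
qed

text \<open>The estimate by a tail of \<open>K\<close> plus N * pnorm (y n) does not involve s, so
  the convergence it yields is uniform in s.\<close>

lemma rn_uniform_nullI:
  assumes f: "\<And>n s. s \<in> S \<Longrightarrow> f n s \<in> carrier X" and K: "K \<in> borel_measurable M"
    and y: "\<And>n. y n \<in> carrier X" "limitin (rn_topology M X) y \<zero>\<^bsub>X\<^esub> sequentially"
    and le: "\<And>n s. s \<in> S \<Longrightarrow> AE w in M. rnorm (f n s) w \<le> K w * rnorm (y n) w"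
  shows "rn_uniform_null M X f S"
  unfolding rn_uniform_null_def
proof (intro allI impI ballI)
  fix \<epsilon> l :: real assume el: "0 < \<epsilon>" "l \<in> {0<..<1}"
  \<comment> \<open>The \<open>pnorm\<close> threshold for membership in the neighbourhood: one half
    is spent on the tail of \<open>K\<close>, the other on N * pnorm (y n).\<close>
  define c where "c = min 1 \<epsilon> * (1 - l)"
  have "0 < c" using el by (simp add: c_def)
  then obtain N where N: "1 \<le> N" "prob {w \<in> space M. N < K w} < c / 2"
    using prob_greater_tendsto_0[OF K, of "c / 2"] by auto
  have "(\<lambda>n. pdist (y n) \<zero>\<^bsub>X\<^esub>) \<longlonglongrightarrow> 0"
    using y(2) by (simp add: limitin_rn_topology)
  moreover have "pdist (y n) \<zero>\<^bsub>X\<^esub> = pnorm (y n)" for n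
    using y(1) by (simp add: pdist_def diff_zero)
  ultimately have "(\<lambda>n. pnorm (y n)) \<longlonglongrightarrow> 0" by simp
  then have "\<forall>\<^sub>F n in sequentially. pnorm (y n) < c / (2 * N)"
    using \<open>0 < c\<close> N(1) by (intro order_tendstoD(2)) auto
  then show "\<forall>\<^sub>F n in sequentially. \<forall>s\<in>S. f n s \<in> rn_nbhd M X \<epsilon> l"
  proof eventually_elim
    case (elim n)
    show ?case
    proof
      fix s assume s: "s \<in> S"
      have "pnorm (f n s) \<le> prob {w \<in> space M. N < K w} + N * pnorm (y n)"
        using s N(1) by (intro pnorm_le_truncate f y K le)
      moreover have "N * pnorm (y n) < c / 2"
        using elim N(1) by (simp add: field_simps)
      ultimately have "pnorm (f n s) < c" using N(2) by linarith
      then show "f n s \<in> rn_nbhd M X \<epsilon> l"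
        using s el unfolding c_def by (intro rn_nbhdI f) auto
    qed
  qed
qed

end

section \<open>The graph module\<close>

locale rn_operator = rn_module M X for M :: "'w measure" and
    X :: "('w, 'k::{real_normed_field, euclidean_space}, 'x) rn_struct" +
  fixes D :: "'x set" and A :: "'x \<Rightarrow> 'x"
  assumes submodule_domain: "submodule D (L0_ring M) X"
    and hom: "A \<in> module_homs (L0_ring M) (X\<lparr>carrier := D\<rparr>) X"
begin

lemma domain_subset: "D \<subseteq> carrier X"
  using submoduleE(1)[OF submodule_domain] .

lemma image_closed: "x \<in> D \<Longrightarrow> A x \<in> carrier X"
  and image_add: "x \<in> D \<Longrightarrow> y \<in> D \<Longrightarrow> A (x \<oplus>\<^bsub>X\<^esub> y) = A x \<oplus>\<^bsub>X\<^esub> A y"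
  and image_smult: "\<xi> \<in> L0 M \<Longrightarrow> x \<in> D \<Longrightarrow> A (\<xi> \<odot>\<^bsub>X\<^esub> x) = \<xi> \<odot>\<^bsub>X\<^esub> A x"
  using hom by (auto simp: module_homs_def carrier_L0_ring)

abbreviation G :: "('w, 'k, 'x) rn_struct" where
  "G \<equiv> graph_module M X D A"

lemma graph_module_simps [simp]:
  "carrier G = D" "add G = add X" "zero G = zero X" "smult G = smult X"
  "L0norm G x = L0norm X x \<oplus>\<^bsub>L0_ring M\<^esub> L0norm X (A x)"
  by (simp_all add: graph_module_def)

lemma image_diff:
  assumes "x \<in> D" "y \<in> D"
  shows "x \<ominus>\<^bsub>X\<^esub> y \<in> D" "A (x \<ominus>\<^bsub>X\<^esub> y) = A x \<ominus>\<^bsub>X\<^esub> A y"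
proof -
  have minus_y: "\<ominus>\<^bsub>X\<^esub> y \<in> D"
    using submoduleE(3)[OF submodule_domain] assms by blast
  then show "x \<ominus>\<^bsub>X\<^esub> y \<in> D"
    unfolding a_minus_def using submoduleE(5)[OF submodule_domain] assms by blast
  have "A (\<ominus>\<^bsub>X\<^esub> y) = \<ominus>\<^bsub>X\<^esub> A y"
    using image_smult[OF L0_const_in assms(2), of "-1"] assms(2) domain_subset image_closed
    by (auto simp: cmult_minus_one)
  then show "A (x \<ominus>\<^bsub>X\<^esub> y) = A x \<ominus>\<^bsub>X\<^esub> A y"
    using assms(1) minus_y by (simp add: a_minus_def image_add)
qed

lemma graph_norm_eq:
  assumes "x \<in> D"
  shows "L0norm G x = ae_rel M `` {\<lambda>w. rnorm x w + rnorm (A x) w}"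
  using assms domain_subset image_closed[OF assms]
  by (auto simp: L0norm_eq L0_add_class measurable_rnorm)

text \<open>Homogeneity holds because \<open>A\<close> commutes with all random scalars, and
  definiteness comes from the first summand. The sublocale then provides the metric and the operator
  bounds for the graph norm.\<close>

lemma rn_module_graph: "rn_module M G"
proof (intro rn_module.intro prob_space_axioms rn_module_axioms.intro)
  have "module (L0_ring M) (X\<lparr>carrier := D\<rparr>)"
    using submodule.submodule_is_module[OF submodule_domain] module_axioms by blast
  \<comment> \<open>The module laws do not mention the norm field, so replacing the norm on the
    submodule leaves them intact.\<close>
  then show mod: "module (L0_ring M) G"
    by (simp add: module_def abelian_group_def abelian_monoid_def abelian_group_axioms_def
        module_axioms_def graph_module_def)
  have meas: "rnorm x \<in> borel_measurable M" "rnorm (A x) \<in> borel_measurable M"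
    and nonneg: "0 \<le> rnorm x w" "0 \<le> rnorm (A x) w" if "x \<in> D" for x w
    using that domain_subset image_closed by (auto simp: measurable_rnorm rnorm_nonneg)
  show "L0norm G x \<in> L0_plus M" if "x \<in> carrier G" for x
    using that meas nonneg unfolding graph_module_simps(1)
    by (subst graph_norm_eq) (auto intro!: L0_plus_class)
  show "L0norm G (\<xi> \<odot>\<^bsub>G\<^esub> x) = L0_map M norm \<xi> \<otimes>\<^bsub>L0_ring M\<^esub> L0norm G x"
    if "\<xi> \<in> L0 M" "x \<in> carrier G" for \<xi> x
  proof -
    have x: "x \<in> D" using that by simp
    have closed: "x \<in> carrier X" "A x \<in> carrier X"
      using x domain_subset image_closed by auto
    obtain f where "f \<in> borel_measurable M" "\<xi> = ae_rel M `` {f}"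
      using \<open>\<xi> \<in> L0 M\<close> by (rule L0_cases)
    then have "L0_map M norm \<xi> = ae_rel M `` {\<lambda>w. norm (f w)}" "(\<lambda>w. norm (f w)) \<in> borel_measurable M"
      by (simp_all add: L0_map_class)
    then show ?thesis
      using that x closed meas[OF x]
      by (simp add: image_smult L0norm_smult L0norm_eq L0_mult_class L0_add_class distrib_left)
  qed
  show "L0_le M (L0norm G (x \<oplus>\<^bsub>G\<^esub> y)) (L0norm G x \<oplus>\<^bsub>L0_ring M\<^esub> L0norm G y)"
    if "x \<in> carrier G" "y \<in> carrier G" for x y
  proof -
    have xy: "x \<in> D" "y \<in> D" "x \<oplus>\<^bsub>X\<^esub> y \<in> D"
      using that submoduleE(5)[OF submodule_domain] by auto
    have "AE w in M. rnorm (x \<oplus>\<^bsub>X\<^esub> y) w \<le> rnorm x w + rnorm y w"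
      using xy domain_subset by (intro rnorm_add) auto
    moreover have "AE w in M. rnorm (A (x \<oplus>\<^bsub>X\<^esub> y)) w \<le> rnorm (A x) w + rnorm (A y) w"
      using xy by (simp add: image_add image_closed rnorm_add)
    ultimately have "AE w in M. rnorm (x \<oplus>\<^bsub>X\<^esub> y) w + rnorm (A (x \<oplus>\<^bsub>X\<^esub> y)) w
        \<le> (rnorm x w + rnorm (A x) w) + (rnorm y w + rnorm (A y) w)"
      by eventually_elim simp
    then show ?thesis
      using meas xy by (simp add: graph_norm_eq L0_add_class L0_le_class del: graph_module_simps(5))
  qed
  show "x = \<zero>\<^bsub>G\<^esub>" if "x \<in> carrier G" "L0norm G x = \<zero>\<^bsub>L0_ring M\<^esub>" for x
  proof -
    have x: "x \<in> D" using that by simp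
    have "ae_rel M `` {\<lambda>w. rnorm x w + rnorm (A x) w} = ae_rel M `` {\<lambda>_. 0}"
      using that(2) unfolding graph_norm_eq[OF x] L0_zero_class .
    then have "AE w in M. rnorm x w + rnorm (A x) w = 0"
      using meas[OF x] by (subst (asm) ae_class_eq_iff) auto
    then have "AE w in M. rnorm x w = 0"
      by eventually_elim (use nonneg[OF x] in \<open>simp add: add_nonneg_eq_0_iff\<close>)
    then show ?thesis
      using x domain_subset rnorm_eq_zero[of x] by auto
  qed
qed

end

sublocale rn_operator \<subseteq> graph: rn_module M "graph_module M X D A"
  by (rule rn_module_graph)

context rn_operator
begin

text \<open>Additive inverses are defined relative to the carrier, so shrinking it to
  \<open>D\<close> changes the defining term; both inverses are the multiple by -1.\<close>

lemma graph_diff: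
  assumes "x \<in> D" "y \<in> D"
  shows "x \<ominus>\<^bsub>G\<^esub> y = x \<ominus>\<^bsub>X\<^esub> y"
proof -
  have "\<ominus>\<^bsub>G\<^esub> y = graph.cmult (- 1) y"
    using graph.cmult_minus_one[of y] assms by simp
  also have "\<dots> = \<ominus>\<^bsub>X\<^esub> y"
    using assms domain_subset by (auto simp: cmult_minus_one)
  finally show ?thesis by (simp add: a_minus_def)
qed

lemma graph_rnorm:
  assumes "x \<in> D"
  shows "AE w in M. graph.rnorm x w = rnorm x w + rnorm (A x) w"
proof -
  have "x \<in> carrier X" "A x \<in> carrier X" "x \<in> carrier G"
    using assms domain_subset image_closed by auto
  note x = this
  have "ae_rel M `` {graph.rnorm x} = ae_rel M `` {\<lambda>w. rnorm x w + rnorm (A x) w}"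
    using graph.L0norm_eq[OF x(3)] graph_norm_eq[OF assms] by simp
  then show ?thesis
    using x by (subst (asm) ae_class_eq_iff) (auto simp: measurable_rnorm graph.measurable_rnorm)
qed

lemma rn_nbhd_graph:
  assumes "x \<in> rn_nbhd M G \<epsilon> l"
  shows "x \<in> rn_nbhd M X \<epsilon> l" "A x \<in> rn_nbhd M X \<epsilon> l"
proof -
  have x: "x \<in> D" using assms by (simp add: rn_nbhd_def)
  then have X: "x \<in> carrier X" "A x \<in> carrier X" "x \<in> carrier G"
    using domain_subset image_closed by auto
  have le: "AE w in M. graph.rnorm x w < \<epsilon> \<longrightarrow> rnorm x w < \<epsilon> \<and> rnorm (A x) w < \<epsilon>"
    using graph_rnorm[OF x]
    by eventually_elim (use rnorm_nonneg[OF X(1)] rnorm_nonneg[OF X(2)] in \<open>smt (verit)\<close>)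
  have [measurable]: "rnorm x \<in> borel_measurable M" "rnorm (A x) \<in> borel_measurable M"
    using X by (simp_all add: measurable_rnorm)
  have l: "l < prob {w \<in> space M. graph.rnorm x w < \<epsilon>}"
    using assms X by (simp add: graph.rn_nbhd_iff)
  have "prob {w \<in> space M. graph.rnorm x w < \<epsilon>} \<le> prob {w \<in> space M. rnorm x w < \<epsilon>}"
    by (rule finite_measure_mono_AE) (use le in auto)
  with l X show "x \<in> rn_nbhd M X \<epsilon> l" by (simp add: rn_nbhd_iff)
  have "prob {w \<in> space M. graph.rnorm x w < \<epsilon>} \<le> prob {w \<in> space M. rnorm (A x) w < \<epsilon>}"
    by (rule finite_measure_mono_AE) (use le in auto)
  with l X show "A x \<in> rn_nbhd M X \<epsilon> l" by (simp add: rn_nbhd_iff)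
qed

text \<open>The norm of A x is at most the graph norm of x, so one pair of neighbourhood parameters
  serves on both sides.\<close>

lemma continuous_map_graph_operator: "continuous_map (rn_topology M G) (rn_topology M X) A"
  unfolding continuous_map_def
proof (intro conjI allI impI)
  show "A \<in> topspace (rn_topology M G) \<rightarrow> topspace (rn_topology M X)"
    using image_closed by (simp add: topspace_rn_topology graph.topspace_rn_topology)
  fix U assume U: "openin (rn_topology M X) U"
  show "openin (rn_topology M G) {x \<in> topspace (rn_topology M G). A x \<in> U}"
    unfolding graph.openin_rn_topology graph.topspace_rn_topology
  proof (intro conjI ballI)
    fix x assume "x \<in> {x \<in> carrier G. A x \<in> U}"
    then have x: "x \<in> D" "A x \<in> U" by auto
    obtain \<epsilon> l where el: "0 < \<epsilon>" "l \<in> {0<..<1}"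
      and sub: "\<And>y. y \<in> carrier X \<Longrightarrow> y \<ominus>\<^bsub>X\<^esub> A x \<in> rn_nbhd M X \<epsilon> l \<Longrightarrow> y \<in> U"
      using U x unfolding openin_rn_topology by blast
    have "A y \<in> U" if "y \<in> D" "y \<ominus>\<^bsub>G\<^esub> x \<in> rn_nbhd M G \<epsilon> l" for y
      using that x rn_nbhd_graph(2)[OF that(2)]
      by (intro sub image_closed) (simp_all add: graph_diff image_diff)
    then show "\<exists>\<epsilon>>0. \<exists>l\<in>{0<..<1}. \<forall>y\<in>carrier G. y \<ominus>\<^bsub>G\<^esub> x \<in> rn_nbhd M G \<epsilon> l \<longrightarrow>
        y \<in> {x \<in> carrier G. A x \<in> U}"
      using el by (intro exI[of _ \<epsilon>] conjI bexI[of _ l]) auto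
  qed auto
qed

end

section \<open>The fundamental theorem of calculus\<close>

lemma eventually_mesh_filter:
  "eventually P (mesh_filter a b) \<longleftrightarrow>
     (\<exists>\<delta>>0. \<forall>p. p tagged_division_of {a..b} \<and> (\<forall>(t, J)\<in>p. measure lborel J < \<delta>) \<longrightarrow> P p)"
proof -
  have "eventually P (mesh_filter a b) \<longleftrightarrow> (\<exists>\<delta>\<in>{0<..}. eventually P
      (principal {p. p tagged_division_of {a..b} \<and> (\<forall>(t, J)\<in>p. measure lborel J < \<delta>)}))"
    unfolding mesh_filter_def
  proof (rule eventually_INF_base)
    fix d e :: real assume de: "d \<in> {0<..}" "e \<in> {0<..}"
    show "\<exists>x\<in>{0<..}. principal {p. p tagged_division_of {a..b} \<and> (\<forall>(t, J)\<in>p. measure lborel J < x)}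
        \<le> inf (principal {p. p tagged_division_of {a..b} \<and> (\<forall>(t, J)\<in>p. measure lborel J < d)})
              (principal {p. p tagged_division_of {a..b} \<and> (\<forall>(t, J)\<in>p. measure lborel J < e)})"
      using de by (intro bexI[of _ "min d e"]) auto
  qed auto
  then show ?thesis by (auto simp: eventually_principal)
qed

text \<open>Cousin's lemma with the constant gauge \<delta> / 3: a cell inside such a ball has
  length at most 2 \<delta> / 3. This makes the mesh filter nontrivial.\<close>

lemma small_mesh_tagged_division_exists:
  fixes a b \<delta> :: real
  assumes "0 < \<delta>"
  obtains p where "p tagged_division_of {a..b}" "\<forall>(t, J)\<in>p. measure lborel J < \<delta>"
proof -
  obtain p where p: "p tagged_division_of {a..b}" "(\<lambda>x. ball x (\<delta> / 3)) fine p"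
    using fine_division_exists_real[of "\<lambda>x. ball x (\<delta> / 3)" a b] assms by (auto simp: gauge_def)
  have "measure lborel J < \<delta>" if J_in: "(t, J) \<in> p" for t J
  proof -
    obtain c d where J: "J = cbox c d"
      using tagged_division_ofD(4)[OF p(1) J_in] by blast
    have "J \<subseteq> ball t (\<delta> / 3)"
      using fineD[OF p(2) J_in] .
    also have "\<dots> \<subseteq> {t - \<delta> / 3 .. t + \<delta> / 3}"
      by (auto simp: ball_eq_greaterThanLessThan)
    finally have "J \<subseteq> {t - \<delta> / 3 .. t + \<delta> / 3}" .
    then have "measure lborel J \<le> measure lborel {t - \<delta> / 3 .. t + \<delta> / 3}"
      using content_subset[of c d "t - \<delta> / 3" "t + \<delta> / 3"] by (simp add: J)
    then show ?thesis using assms by simp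
  qed
  then show thesis
    by (intro that[OF p(1)]) auto
qed

lemma mesh_filter_neq_bot: "mesh_filter a b \<noteq> bot"
  unfolding trivial_limit_def eventually_mesh_filter
  by (metis small_mesh_tagged_division_exists)

lemma sum_measure_tagged_division:
  assumes "p tagged_division_of {a..b::real}" "a \<le> b"
  shows "(\<Sum>(t, J)\<in>p. measure lborel J) = b - a"
  using additive_content_tagged_division[of p a b] assms by simp

lemma atin_within_euclidean: "atin_within euclidean s S = at s within S"
  by (auto simp: filter_eq_iff eventually_atin_within eventually_at_topological)

context rn_module
begin

section \<open>Finite weighted sums and Riemann sums\<close>

lemma rnorm_finsum:
  assumes "finite p" "\<And>i. i \<in> p \<Longrightarrow> x i \<in> carrier X"
  shows "AE w in M. rnorm (finsum X (\<lambda>i. cmult (c i) (x i)) p) w \<le> (\<Sum>i\<in>p. norm (c i) * rnorm (x i) w)"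
  using assms
proof (induction p)
  case empty
  show ?case
    unfolding M.finsum_empty sum.empty using rnorm_zero by eventually_elim simp
next
  case (insert i p)
  let ?S = "finsum X (\<lambda>i. cmult (c i) (x i)) p"
  have closed: "x i \<in> carrier X" "(\<lambda>i. cmult (c i) (x i)) \<in> p \<rightarrow> carrier X"
    using insert.prems by auto
  have eq: "finsum X (\<lambda>i. cmult (c i) (x i)) (insert i p) = cmult (c i) (x i) \<oplus>\<^bsub>X\<^esub> ?S"
    using insert.hyps closed by (subst M.finsum_insert) auto
  have "AE w in M. rnorm (cmult (c i) (x i) \<oplus>\<^bsub>X\<^esub> ?S) w \<le> rnorm (cmult (c i) (x i)) w + rnorm ?S w"
    using closed by (intro rnorm_add M.finsum_closed) auto
  moreover have "AE w in M. rnorm ?S w \<le> (\<Sum>i\<in>p. norm (c i) * rnorm (x i) w)"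
    by (rule insert.IH) (use insert.prems in simp)
  ultimately show ?case
    using rnorm_cmult[OF closed(1), of "c i"] unfolding eq sum.insert[OF insert.hyps]
    by eventually_elim simp
qed

text \<open>Convex combinations are controlled by \<^term>\<open>pnorm\<close>, which is not convex, only at the cost
  of the factor \<open>N\<close> and the tail of a common bound \<open>B\<close>.\<close>

lemma pnorm_convex_combination:
  assumes p: "finite p" and x: "\<And>i. i \<in> p \<Longrightarrow> x i \<in> carrier X"
    and m: "\<And>i. i \<in> p \<Longrightarrow> 0 \<le> m i" "(\<Sum>i\<in>p. m i) = 1"
    and B [measurable]: "B \<in> borel_measurable M"
    and le: "\<And>i. i \<in> p \<Longrightarrow> AE w in M. rnorm (x i) w \<le> B w"
    and d: "\<And>i. i \<in> p \<Longrightarrow> pnorm (x i) \<le> d" and "1 \<le> N"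
  shows "pnorm (finsum X (\<lambda>i. cmult (of_real (m i)) (x i)) p) \<le> prob {w \<in> space M. N < B w} + N * d"
proof -
  let ?A = "{w \<in> space M. N < B w}" and ?S = "finsum X (\<lambda>i. cmult (of_real (m i)) (x i)) p"
  have S: "?S \<in> carrier X"
    using x by (intro M.finsum_closed) auto
  have A: "?A \<in> events" by measurable
  then have intA: "integrable M (indicator ?A :: 'w \<Rightarrow> real)"
    by (intro integrable_real_indicator) (simp_all add: emeasure_eq_measure)
  have int_sum: "integrable M (\<lambda>w. \<Sum>i\<in>p. m i * (N * min 1 (rnorm (x i) w)))"
    using x integrable_min_rnorm by (intro Bochner_Integration.integrable_sum) auto
  have "AE w in M. \<forall>i\<in>p. rnorm (x i) w \<le> B w"
    using le p by (intro AE_finite_allI) auto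
  moreover have "AE w in M. rnorm ?S w \<le> (\<Sum>i\<in>p. norm (of_real (m i) :: 'k) * rnorm (x i) w)"
    using p x by (rule rnorm_finsum)
  ultimately have "AE w in M. min 1 (rnorm ?S w) \<le> indicator ?A w + (\<Sum>i\<in>p. m i * (N * min 1 (rnorm (x i) w)))"
    using AE_space
  proof eventually_elim
    case (elim w)
    have nonneg: "0 \<le> m i * (N * min 1 (rnorm (x i) w))" if "i \<in> p" for i
      using that x m(1) rnorm_nonneg \<open>1 \<le> N\<close> by simp
    show ?case
    proof (cases "w \<in> ?A")
      case True
      then show ?thesis
        using sum_nonneg[of p "\<lambda>i. m i * (N * min 1 (rnorm (x i) w))"] nonneg by simp
    next
      case False
      with elim have BN: "B w \<le> N" by simp
      have "rnorm ?S w \<le> (\<Sum>i\<in>p. m i * rnorm (x i) w)"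
        using elim(2) m(1) by simp
      \<comment> \<open>For 0 \<le> r \<le> N one has r \<le> N * min 1 r: if r \<le> 1 because 1
        \<le> N, otherwise because r \<le> N.\<close>
      also have "\<dots> \<le> (\<Sum>i\<in>p. m i * (N * min 1 (rnorm (x i) w)))"
      proof (intro sum_mono mult_left_mono m(1))
        fix i assume i: "i \<in> p"
        then have "rnorm (x i) w \<le> N" using elim(1) BN by force
        moreover have "1 * rnorm (x i) w \<le> N * rnorm (x i) w"
          using rnorm_nonneg x i \<open>1 \<le> N\<close> by (intro mult_right_mono) auto
        ultimately show "rnorm (x i) w \<le> N * min 1 (rnorm (x i) w)"
          by (auto simp: min_def)
      qed
      finally show ?thesis using False by simp
    qed
  qed
  then have "pnorm ?S \<le> (\<integral>w. indicator ?A w + (\<Sum>i\<in>p. m i * (N * min 1 (rnorm (x i) w))) \<partial>M)"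
    unfolding pnorm_def using S intA int_sum
    by (intro integral_mono_AE integrable_min_rnorm Bochner_Integration.integrable_add) auto
  also have "\<dots> = prob ?A + (\<Sum>i\<in>p. m i * (N * pnorm (x i)))"
    using A intA int_sum x integrable_min_rnorm
    by (simp add: pnorm_def Bochner_Integration.integral_sum)
  also have "(\<Sum>i\<in>p. m i * (N * pnorm (x i))) \<le> (\<Sum>i\<in>p. m i * (N * d))"
    using d m(1) \<open>1 \<le> N\<close> by (intro sum_mono mult_left_mono) auto
  also have "\<dots> = N * d"
    using m(2) by (simp flip: sum_distrib_right)
  finally show ?thesis by simp
qed

lemma add_diff_add:
  assumes "a \<in> carrier X" "b \<in> carrier X" "c \<in> carrier X" "d \<in> carrier X"
  shows "(a \<oplus>\<^bsub>X\<^esub> b) \<ominus>\<^bsub>X\<^esub> (c \<oplus>\<^bsub>X\<^esub> d) = (a \<ominus>\<^bsub>X\<^esub> c) \<oplus>\<^bsub>X\<^esub> (b \<ominus>\<^bsub>X\<^esub> d)"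
  using assms by (simp add: a_minus_def M.minus_add M.a_ac)

text \<open>Applied with total weight 1, where it turns the distance of a mean from \<open>y\<close>
  into a mean of deviations from \<open>y\<close>.\<close>

lemma finsum_cmult_diff:
  assumes "finite p" "\<And>i. i \<in> p \<Longrightarrow> x i \<in> carrier X" "y \<in> carrier X"
  shows "finsum X (\<lambda>i. cmult (of_real (m i)) (x i \<ominus>\<^bsub>X\<^esub> y)) p =
    finsum X (\<lambda>i. cmult (of_real (m i)) (x i)) p \<ominus>\<^bsub>X\<^esub> cmult (of_real (\<Sum>i\<in>p. m i)) y"
  using assms(1,2)
proof (induction p)
  case empty
  show ?case using assms(3) by (simp add: cmult_zero_left diff_zero)
next
  case (insert i p)
  have "(\<lambda>i. cmult (of_real (m i)) (x i)) \<in> p \<rightarrow> carrier X"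
    "(\<lambda>i. cmult (of_real (m i)) (x i \<ominus>\<^bsub>X\<^esub> y)) \<in> p \<rightarrow> carrier X"
    using insert.prems assms(3) by auto
  then show ?case
    using insert assms(3)
    by (simp add: M.finsum_insert cmult_diff_right cmult_add_left add_diff_add)
qed

lemma riemann_sum_closed:
  assumes "\<And>t J. (t, J) \<in> p \<Longrightarrow> g t \<in> carrier X"
  shows "riemann_sum M X g p \<in> carrier X"
  unfolding riemann_sum_def case_prod_beta
  using assms[of "fst i" "snd i" for i] by (intro M.finsum_closed) auto

text \<open>Two tagged divisions of adjacent intervals may share a degenerate interval.\<close>

lemma riemann_sum_Un:
  assumes "finite p" "finite q"
    and g: "\<And>t J. (t, J) \<in> p \<union> q \<Longrightarrow> g t \<in> carrier X"
    and null: "\<And>t J. (t, J) \<in> p \<inter> q \<Longrightarrow> measure lborel J = 0"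
  shows "riemann_sum M X g (p \<union> q) = riemann_sum M X g p \<oplus>\<^bsub>X\<^esub> riemann_sum M X g q"
proof -
  let ?f = "\<lambda>i. cmult (of_real (measure lborel (snd i))) (g (fst i))"
  have g_fst: "g (fst i) \<in> carrier X" if "i \<in> p \<union> q" for i
    using that g[of "fst i" "snd i"] by simp
  then have f: "?f \<in> p \<rightarrow> carrier X" "?f \<in> q \<rightarrow> carrier X"
    by auto
  have "?f i = \<zero>\<^bsub>X\<^esub>" if "i \<in> p \<inter> q" for i
    using that null[of "fst i" "snd i"] g_fst[of i] by (simp add: cmult_zero_left)
  then have "finsum X ?f (p \<inter> q) = finsum X (\<lambda>_. \<zero>\<^bsub>X\<^esub>) (p \<inter> q)"
    by (intro M.finsum_cong') auto
  then have "finsum X ?f (p \<inter> q) = \<zero>\<^bsub>X\<^esub>" by simp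
  moreover have "finsum X ?f (p \<union> q) \<in> carrier X"
    using f by (intro M.finsum_closed) auto
  ultimately show ?thesis
    unfolding riemann_sum_def case_prod_beta
    using M.finsum_Un_Int[OF assms(1,2) f] f by (simp add: M.finsum_closed)
qed

text \<open>A fine division of [a, b] joined to a fine division \<open>q\<close> of [b, c] is a fine
  division of [a, c], so the Riemann sum over \<open>q\<close> is close to J - I. This stands in for
  additivity and spares a proof that \<open>g\<close> is integrable over [b, c].\<close>

lemma integral_increment_approx:
  assumes g: "\<And>t. t \<in> {a..c} \<Longrightarrow> g t \<in> carrier X" and "a \<le> b" "b \<le> c"
    and I: "rn_has_integral M X g I a b" and J: "rn_has_integral M X g J a c" and "0 < e"
  obtains q where "q tagged_division_of {b..c}" "pnorm ((J \<ominus>\<^bsub>X\<^esub> I) \<ominus>\<^bsub>X\<^esub> riemann_sum M X g q) < e"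
proof -
  have IJ: "I \<in> carrier X" "J \<in> carrier X"
    using I J by (auto simp: rn_has_integral_def limitin_rn_topology)
  have "((\<lambda>p. pdist (riemann_sum M X g p) I) \<longlongrightarrow> 0) (mesh_filter a b)"
    using I by (simp add: rn_has_integral_def limitin_rn_topology)
  from order_tendstoD(2)[OF this, of "e / 2"]
  have "\<forall>\<^sub>F p in mesh_filter a b. pdist (riemann_sum M X g p) I < e / 2"
    using \<open>0 < e\<close> by simp
  then obtain d1 where d1: "0 < d1"
    "\<And>p. p tagged_division_of {a..b} \<Longrightarrow> \<forall>(t, J)\<in>p. measure lborel J < d1 \<Longrightarrow>
      pdist (riemann_sum M X g p) I < e / 2"
    unfolding eventually_mesh_filter by blast
  have "((\<lambda>p. pdist (riemann_sum M X g p) J) \<longlongrightarrow> 0) (mesh_filter a c)"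
    using J by (simp add: rn_has_integral_def limitin_rn_topology)
  from order_tendstoD(2)[OF this, of "e / 2"]
  have "\<forall>\<^sub>F p in mesh_filter a c. pdist (riemann_sum M X g p) J < e / 2"
    using \<open>0 < e\<close> by simp
  then obtain d2 where d2: "0 < d2"
    "\<And>p. p tagged_division_of {a..c} \<Longrightarrow> \<forall>(t, J)\<in>p. measure lborel J < d2 \<Longrightarrow>
      pdist (riemann_sum M X g p) J < e / 2"
    unfolding eventually_mesh_filter by blast
  obtain p where p: "p tagged_division_of {a..b}" "\<forall>(t, J)\<in>p. measure lborel J < min d1 d2"
    using small_mesh_tagged_division_exists[of "min d1 d2" a b] d1 d2 by auto
  obtain q where q: "q tagged_division_of {b..c}" "\<forall>(t, J)\<in>q. measure lborel J < min d1 d2"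
    using small_mesh_tagged_division_exists[of "min d1 d2" b c] d1 d2 by auto
  have pq: "(p \<union> q) tagged_division_of {a..c}"
    using tagged_division_Un[OF p(1) q(1)] \<open>a \<le> b\<close> \<open>b \<le> c\<close> by (simp add: ivl_disj_un_two_touch)
  have tags: "g t \<in> carrier X" if "(t, K) \<in> p \<union> q" for t K
    using tagged_division_ofD(2,3)[OF pq that] g by blast
  have null: "measure lborel K = 0" if "(t, K) \<in> p \<inter> q" for t K
  proof -
    have "K \<subseteq> {a..b}" "K \<subseteq> {b..c}"
      using that tagged_division_ofD(3)[OF p(1)] tagged_division_ofD(3)[OF q(1)] by blast+
    then have "K \<subseteq> {b}" by force
    then have "K = {} \<or> K = {b}" by blast
    then show ?thesis by auto
  qed
  have closed: "riemann_sum M X g p \<in> carrier X" "riemann_sum M X g q \<in> carrier X"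
    using tags by (auto intro!: riemann_sum_closed)
  have Un: "riemann_sum M X g (p \<union> q) = riemann_sum M X g p \<oplus>\<^bsub>X\<^esub> riemann_sum M X g q"
    using tagged_division_ofD(1)[OF p(1)] tagged_division_ofD(1)[OF q(1)] tags null
    by (rule riemann_sum_Un)
  have P: "pnorm (riemann_sum M X g p \<ominus>\<^bsub>X\<^esub> I) < e / 2"
    using d1(2)[OF p(1)] p(2) IJ closed by (auto simp: pdist_def)
  have Q: "pnorm ((riemann_sum M X g p \<oplus>\<^bsub>X\<^esub> riemann_sum M X g q) \<ominus>\<^bsub>X\<^esub> J) < e / 2"
    using d2(2)[OF pq] p(2) q(2) IJ closed Un by (auto simp: pdist_def)
  \<comment> \<open>The sum over \<open>p\<close> cancels, leaving the two approximation errors over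
    [a, b] and [a, c].\<close>
  have "(J \<ominus>\<^bsub>X\<^esub> I) \<ominus>\<^bsub>X\<^esub> riemann_sum M X g q =
      (riemann_sum M X g p \<ominus>\<^bsub>X\<^esub> I) \<ominus>\<^bsub>X\<^esub> ((riemann_sum M X g p \<oplus>\<^bsub>X\<^esub> riemann_sum M X g q) \<ominus>\<^bsub>X\<^esub> J)"
    using IJ closed by (simp add: a_minus_def M.minus_add M.a_ac M.r_neg1 M.r_neg2)
  also have "pnorm \<dots> \<le> pnorm (riemann_sum M X g p \<ominus>\<^bsub>X\<^esub> I) +
      pnorm ((riemann_sum M X g p \<oplus>\<^bsub>X\<^esub> riemann_sum M X g q) \<ominus>\<^bsub>X\<^esub> J)"
    unfolding a_minus_def[of X "riemann_sum M X g p \<ominus>\<^bsub>X\<^esub> I"]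
    using IJ closed by (intro order.trans[OF pnorm_add]) (simp_all add: pnorm_minus)
  finally have "pnorm ((J \<ominus>\<^bsub>X\<^esub> I) \<ominus>\<^bsub>X\<^esub> riemann_sum M X g q) < e"
    using P Q by linarith
  with q(1) that show thesis by blast
qed

text \<open>Up to an arbitrarily small error the mean over [b, c] is a convex combination of values
  of \<open>g\<close>. Scaling by 1 / (c - b) may enlarge the Riemann error, which is therefore
  taken below e / max 1 (norm r).\<close>

lemma integral_mean_estimate:
  assumes g: "\<And>t. t \<in> {a..c} \<Longrightarrow> g t \<in> carrier X" and "a \<le> b" "b < c"
    and I: "rn_has_integral M X g I a b" and J: "rn_has_integral M X g J a c"
    and x: "x \<in> carrier X" and B: "B \<in> borel_measurable M"
    and le: "\<And>t. t \<in> {b..c} \<Longrightarrow> AE w in M. rnorm (g t \<ominus>\<^bsub>X\<^esub> x) w \<le> B w"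
    and d: "\<And>t. t \<in> {b..c} \<Longrightarrow> pnorm (g t \<ominus>\<^bsub>X\<^esub> x) \<le> d" and "1 \<le> N"
  shows "pnorm (cmult (of_real (1 / (c - b))) (J \<ominus>\<^bsub>X\<^esub> I) \<ominus>\<^bsub>X\<^esub> x) \<le> prob {w \<in> space M. N < B w} + N * d"
proof (rule field_le_epsilon)
  fix e :: real assume "0 < e"
  define r :: 'k where "r = of_real (1 / (c - b))"
  have IJ: "I \<in> carrier X" "J \<in> carrier X"
    using I J by (auto simp: rn_has_integral_def limitin_rn_topology)
  obtain q where q: "q tagged_division_of {b..c}"
    and approx: "pnorm ((J \<ominus>\<^bsub>X\<^esub> I) \<ominus>\<^bsub>X\<^esub> riemann_sum M X g q) < e / max 1 (norm r)"
    using integral_increment_approx[OF g \<open>a \<le> b\<close> _ I J, of "e / max 1 (norm r)"] \<open>0 < e\<close> \<open>b < c\<close>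
    by auto
  let ?S = "riemann_sum M X g q"
  have fin: "finite q" using q by blast
  have tag: "fst i \<in> {b..c}" if "i \<in> q" for i
    using that tagged_division_ofD(2,3)[OF q, of "fst i" "snd i"] by auto
  then have gq: "g (fst i) \<in> carrier X" if "i \<in> q" for i
    using tag[OF that] \<open>a \<le> b\<close> by (intro g) auto
  have S: "?S \<in> carrier X"
    using gq by (intro riemann_sum_closed) force
  \<comment> \<open>Cell lengths normalized by c - b, so that the weights sum to 1.\<close>
  define m where "m i = measure lborel (snd i) / (c - b)" for i :: "real \<times> real set"
  have m: "0 \<le> m i" for i
    using \<open>b < c\<close> by (simp add: m_def)
  have m1: "(\<Sum>i\<in>q. m i) = 1"
    using sum_measure_tagged_division[OF q] \<open>b < c\<close>
    by (simp add: m_def case_prod_beta flip: sum_divide_distrib)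
  have "cmult r ?S = finsum X (\<lambda>i. cmult r (cmult (of_real (measure lborel (snd i))) (g (fst i)))) q"
    unfolding riemann_sum_def case_prod_beta using gq
    by (intro finsum_smult_ldistr fin) (auto simp: carrier_L0_ring L0_const_in)
  also have "\<dots> = finsum X (\<lambda>i. cmult (of_real (m i)) (g (fst i))) q"
    using gq by (intro M.finsum_cong') (auto simp: cmult_cmult r_def m_def)
  finally have "cmult r ?S \<ominus>\<^bsub>X\<^esub> x = finsum X (\<lambda>i. cmult (of_real (m i)) (g (fst i) \<ominus>\<^bsub>X\<^esub> x)) q"
    using finsum_cmult_diff[where x = "\<lambda>i. g (fst i)" and m = m, OF fin _ x] gq x
    by (simp add: m1 cmult_one)
  also have "pnorm \<dots> \<le> prob {w \<in> space M. N < B w} + N * d"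
    using gq x tag by (intro pnorm_convex_combination fin m m1 B le d \<open>1 \<le> N\<close>) auto
  finally have 1: "pnorm (cmult r ?S \<ominus>\<^bsub>X\<^esub> x) \<le> prob {w \<in> space M. N < B w} + N * d" .
  have "pnorm (cmult r (J \<ominus>\<^bsub>X\<^esub> I) \<ominus>\<^bsub>X\<^esub> cmult r ?S) \<le> max 1 (norm r) * pnorm ((J \<ominus>\<^bsub>X\<^esub> I) \<ominus>\<^bsub>X\<^esub> ?S)"
    using pnorm_cmult[of "(J \<ominus>\<^bsub>X\<^esub> I) \<ominus>\<^bsub>X\<^esub> ?S" r] IJ S by (simp add: cmult_diff_right)
  also have "\<dots> < e"
    using approx by (simp add: pos_less_divide_eq mult.commute)
  finally have 2: "pnorm (cmult r (J \<ominus>\<^bsub>X\<^esub> I) \<ominus>\<^bsub>X\<^esub> cmult r ?S) < e" .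
  have "pnorm (cmult r (J \<ominus>\<^bsub>X\<^esub> I) \<ominus>\<^bsub>X\<^esub> x)
      \<le> pnorm (cmult r (J \<ominus>\<^bsub>X\<^esub> I) \<ominus>\<^bsub>X\<^esub> cmult r ?S) + pnorm (cmult r ?S \<ominus>\<^bsub>X\<^esub> x)"
    using pnorm_add[of "cmult r (J \<ominus>\<^bsub>X\<^esub> I) \<ominus>\<^bsub>X\<^esub> cmult r ?S" "cmult r ?S \<ominus>\<^bsub>X\<^esub> x"] IJ S x
    by (simp add: minus_add_minus_cancel)
  with 1 2 show "pnorm (cmult (of_real (1 / (c - b))) (J \<ominus>\<^bsub>X\<^esub> I) \<ominus>\<^bsub>X\<^esub> x)
      \<le> prob {w \<in> space M. N < B w} + N * d + e"
    unfolding r_def by linarith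
qed

section \<open>Differentiating an integral with respect to its upper limit\<close>

lemma rn_continuous_tendsto:
  assumes "rn_continuous M X g" "0 \<le> s"
  shows "((\<lambda>t. pdist (g t) (g s)) \<longlongrightarrow> 0) (at s within {0..})"
proof -
  have "limitin (rn_topology M X) g (g s) (at s within {0..})"
    using limit_continuous_map_within[of euclidean "{0..}" "rn_topology M X" g s] assms
    by (simp add: rn_continuous_def atin_within_euclidean)
  then show ?thesis by (simp add: limitin_rn_topology)
qed

lemma rn_continuous_closed:
  assumes "rn_continuous M X g" "0 \<le> s"
  shows "g s \<in> carrier X"
  using assms continuous_map_funspace[of "top_of_set {0..}" "rn_topology M X" g]
  by (auto simp: rn_continuous_def topspace_rn_topology)

text \<open>The topology is not locally convex, and continuity alone would not suffice: the mean values
  of \<open>g\<close> are controlled through its local a.s. bound.\<close>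

lemma rn_has_deriv_integral:
  assumes cont: "rn_continuous M X g"
    and bound: "\<And>l. 0 < l \<Longrightarrow> \<exists>B\<in>borel_measurable M. \<forall>t\<in>{0..l}. AE w in M. rnorm (g t) w \<le> B w"
    and F: "\<And>t. 0 \<le> t \<Longrightarrow> F t \<in> carrier X" and z: "z \<in> carrier X"
    and int: "\<And>t. 0 \<le> t \<Longrightarrow> rn_has_integral M X g (F t \<ominus>\<^bsub>X\<^esub> z) 0 t"
    and s: "0 \<le> s"
  shows "rn_has_deriv M X F (g s) s"
proof -
  note g = rn_continuous_closed[OF cont]
  let ?q = "\<lambda>t. cmult (of_real (1 / (t - s))) (F t \<ominus>\<^bsub>X\<^esub> F s)"
  have q: "?q t \<in> carrier X" if "0 \<le> t" for t
    using that s F by simp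
  \<comment> \<open>Reaching to s + 1 makes the bound cover every t \<ge> 0 within distance 1 of s,
    whence \<open>min 1 \<delta>\<close> below.\<close>
  obtain B where B [measurable]: "B \<in> borel_measurable M"
    and le: "\<And>t. t \<in> {0..s + 1} \<Longrightarrow> AE w in M. rnorm (g t) w \<le> B w"
    using bound[of "s + 1"] s by auto
  have le2: "AE w in M. rnorm (g t \<ominus>\<^bsub>X\<^esub> g s) w \<le> 2 * B w" if "t \<in> {0..s + 1}" for t
  proof -
    have "AE w in M. rnorm (g t \<ominus>\<^bsub>X\<^esub> g s) w \<le> rnorm (g t) w + rnorm (g s) w"
      using that s by (intro rnorm_diff g) auto
    moreover have "AE w in M. rnorm (g t) w \<le> B w" "AE w in M. rnorm (g s) w \<le> B w"
      using that s by (auto intro: le)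
    ultimately show ?thesis by eventually_elim simp
  qed
  have "((\<lambda>t. pdist (?q t) (g s)) \<longlongrightarrow> 0) (at s within {0..})"
  proof (rule tendstoI)
    fix e :: real assume "0 < e"
    obtain N where N: "1 \<le> N" "prob {w \<in> space M. N < 2 * B w} < e / 2"
      using prob_greater_tendsto_0[of "\<lambda>w. 2 * B w" "e / 2"] \<open>0 < e\<close> by auto
    \<comment> \<open>\<open>N\<close> is fixed first from the tail of 2 B, independently of t; then
      N d is e / 2.\<close>
    define d where "d = e / (2 * N)"
    have "0 < d" using \<open>0 < e\<close> N(1) by (simp add: d_def)
    have small: "prob {w \<in> space M. N < 2 * B w} + N * d < e"
      using N by (simp add: d_def)
    have "\<forall>\<^sub>F t in at s within {0..}. pdist (g t) (g s) < d"
      using order_tendstoD(2)[OF rn_continuous_tendsto[OF cont s] \<open>0 < d\<close>] .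
    then obtain \<delta> where \<delta>: "0 < \<delta>" "\<And>t. 0 \<le> t \<Longrightarrow> t \<noteq> s \<Longrightarrow> dist t s < \<delta> \<Longrightarrow> pdist (g t) (g s) < d"
      unfolding eventually_at by auto
    have near: "pnorm (g t \<ominus>\<^bsub>X\<^esub> g s) \<le> d" if "0 \<le> t" "dist t s < \<delta>" for t
    proof (cases "t = s")
      case True
      then have "pnorm (g t \<ominus>\<^bsub>X\<^esub> g s) = 0"
        using g[OF s] by (simp add: pnorm_eq_0_iff minus_eq_zero_iff)
      then show ?thesis using \<open>0 < d\<close> by simp
    next
      case False
      then show ?thesis using \<delta>(2)[OF that(1) False that(2)] that s g by (simp add: pdist_def)
    qed
    have diff: "(F t \<ominus>\<^bsub>X\<^esub> z) \<ominus>\<^bsub>X\<^esub> (F u \<ominus>\<^bsub>X\<^esub> z) = F t \<ominus>\<^bsub>X\<^esub> F u" if "0 \<le> t" "0 \<le> u" for t u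
    proof -
      have "(F t \<ominus>\<^bsub>X\<^esub> z) \<ominus>\<^bsub>X\<^esub> (F u \<ominus>\<^bsub>X\<^esub> z) = (F t \<ominus>\<^bsub>X\<^esub> F u) \<oplus>\<^bsub>X\<^esub> (\<zero>\<^bsub>X\<^esub> \<ominus>\<^bsub>X\<^esub> \<zero>\<^bsub>X\<^esub>)"
        using F[OF that(1)] F[OF that(2)] z add_diff_add[of "F t" "\<ominus>\<^bsub>X\<^esub> z" "F u" "\<ominus>\<^bsub>X\<^esub> z"]
        by (simp add: a_minus_def M.l_neg)
      then show ?thesis using F that by (simp add: diff_zero)
    qed
    \<comment> \<open>Letting s be either endpoint treats right and left difference quotients at
      once.\<close>
    have main: "pnorm (cmult (of_real (1 / (v - u))) (F v \<ominus>\<^bsub>X\<^esub> F u) \<ominus>\<^bsub>X\<^esub> g s) < e"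
      if "0 \<le> u" "u < v" "s \<in> {u, v}" "dist u v < min 1 \<delta>" for u v
    proof -
      have "pnorm (cmult (of_real (1 / (v - u))) ((F v \<ominus>\<^bsub>X\<^esub> z) \<ominus>\<^bsub>X\<^esub> (F u \<ominus>\<^bsub>X\<^esub> z)) \<ominus>\<^bsub>X\<^esub> g s)
          \<le> prob {w \<in> space M. N < 2 * B w} + N * d"
        using that g s by (intro integral_mean_estimate[where a = 0 and g = g] int le2 near N(1))
          (auto simp: dist_real_def)
      with small show ?thesis using that by (simp add: diff)
    qed
    have "pdist (?q t) (g s) < e" if t: "0 \<le> t" "t \<noteq> s" "dist t s < min 1 \<delta>" for t
    proof (cases "s < t")
      case True
      then show ?thesis
        using main[of s t] t s g q by (simp add: pdist_def dist_commute)
    next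
      case False
      \<comment> \<open>The increment and the denominator both change sign, so the left quotient is
        the mean over [t, s].\<close>
      have "?q t = cmult (of_real (1 / (s - t))) (F s \<ominus>\<^bsub>X\<^esub> F t)"
      proof -
        have "F t \<ominus>\<^bsub>X\<^esub> F s = \<ominus>\<^bsub>X\<^esub> (F s \<ominus>\<^bsub>X\<^esub> F t)"
          using F t s by (simp add: a_minus_def M.minus_add M.a_comm)
        also have "\<dots> = cmult (- 1) (F s \<ominus>\<^bsub>X\<^esub> F t)"
          using F t s by (simp add: cmult_minus_one)
        finally have "?q t = cmult (of_real (1 / (t - s)) * (- 1)) (F s \<ominus>\<^bsub>X\<^esub> F t)"
          using F t s by (simp only: cmult_cmult M.minus_closed)
        moreover have "of_real (1 / (t - s)) * (- 1) = (of_real (1 / (s - t)) :: 'k)"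
          using t by (simp flip: of_real_minus add: minus_divide_right)
        ultimately show ?thesis by simp
      qed
      then show ?thesis
        using main[of t s] False t s g F by (simp add: pdist_def)
    qed
    then show "\<forall>\<^sub>F t in at s within {0..}. dist (pdist (?q t) (g s)) 0 < e"
      using \<delta>(1) Metric_space.nonneg[OF Metric_space_pdist] unfolding eventually_at
      by (intro exI[of _ "min 1 \<delta>"]) auto
  qed
  moreover have "\<forall>\<^sub>F t in at s within {0..}. ?q t \<in> carrier X"
    using q by (auto simp: eventually_at_filter)
  ultimately show ?thesis
    unfolding rn_has_deriv_def limitin_rn_topology using g s by simp
qed

text \<open>Every cell is the point itself and has length 0. At s = 0 this extracts the initial
  value V(0) x = C x from the integral identity.\<close>

lemma rn_has_integral_singleton:
  assumes "rn_has_integral M X g I a a" "g a \<in> carrier X"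
  shows "I = \<zero>\<^bsub>X\<^esub>"
proof -
  have "riemann_sum M X g p = \<zero>\<^bsub>X\<^esub>" if p: "p tagged_division_of {a..a}" for p
  proof -
    have "cmult (of_real (measure lborel (snd i))) (g (fst i)) = \<zero>\<^bsub>X\<^esub>" if "i \<in> p" for i
    proof -
      have "snd i \<subseteq> {a}" "fst i \<in> snd i"
        using that tagged_division_ofD(2,3)[OF p, of "fst i" "snd i"] by auto
      then have "snd i = {a}" "fst i = a" by auto
      then show ?thesis using assms(2) by (simp add: cmult_zero_left)
    qed
    then have "riemann_sum M X g p = finsum X (\<lambda>_. \<zero>\<^bsub>X\<^esub>) p"
      unfolding riemann_sum_def case_prod_beta by (intro M.finsum_cong') auto
    then show ?thesis by simp
  qed
  then have "\<forall>\<^sub>F p in mesh_filter a a. riemann_sum M X g p = \<zero>\<^bsub>X\<^esub>"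
    unfolding eventually_mesh_filter by (intro exI[of _ 1]) auto
  then have "limitin (rn_topology M X) (riemann_sum M X g) \<zero>\<^bsub>X\<^esub> (mesh_filter a a)"
    by (intro limitin_eventually) (auto simp: topspace_rn_topology)
  from limitin_rn_topology_unique[OF assms(1)[unfolded rn_has_integral_def] this mesh_filter_neq_bot]
  show ?thesis .
qed

end

section \<open>Existence families\<close>

lemma compact_subset_interval:
  fixes S :: "real set"
  assumes "compact S" "S \<subseteq> {0..}"
  obtains l where "0 < l" "S \<subseteq> {0..l}"
proof -
  obtain b where "\<forall>x\<in>S. norm x \<le> b"
    using compact_imp_bounded[OF assms(1)] by (auto simp: bounded_iff)
  then show thesis
    using assms(2) by (intro that[of "max 1 b"]) force+
qed

context rn_operator
begin

section \<open>Mild existence families\<close>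

lemma mild_existence_family_solution:
  assumes V: "mild_existence_family M X D A C V" and C: "C \<in> rn_B M X X" and x: "x \<in> carrier X"
  shows "acp_mild_solution M X D A (C x) (\<lambda>s. V s x)"
  unfolding acp_mild_solution_def
proof (intro conjI allI impI)
  have VB: "\<And>s. 0 \<le> s \<Longrightarrow> V s \<in> rn_B M X X" and bdd: "locally_as_bounded M X V"
    using V by (auto simp: mild_existence_family_def)
  have closed: "V s x \<in> carrier X" if "0 \<le> s" for s
    using VB[OF that] x by (auto simp: rn_B_def)
  have Cx: "C x \<in> carrier X"
    using C x by (auto simp: rn_B_def)
  show "rn_continuous M X (\<lambda>s. V s x)"
    using V x by (simp add: mild_existence_family_def)
  fix s :: real assume s: "0 \<le> s"
  \<comment> \<open>Local boundedness speaks of l > 0 only, while s may be 0.\<close>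
  then have "0 < s + 1" by simp
  then obtain K where K: "K \<in> borel_measurable M"
    and le: "\<And>u z. u \<in> {0..s + 1} \<Longrightarrow> z \<in> carrier X \<Longrightarrow> AE w in M. rnorm (V u z) w \<le> K w * rnorm z w"
    using locally_as_bounded_bound[OF VB bdd] by blast
  show "\<Squnion>\<^bsub>L0bar M\<^esub> ((\<lambda>u. L0_ereal M (L0norm X (V u x))) ` {0..s}) \<in> L0_ereal M ` L0_plus M"
    using s x closed K measurable_rnorm[OF x]
    by (intro Sup_L0norm_in_L0_plus[where B = "\<lambda>w. K w * rnorm x w"] le) auto
  obtain I where I: "I \<in> D" "rn_has_integral M X (\<lambda>u. V u x) I 0 s" "A I = V s x \<ominus>\<^bsub>X\<^esub> C x"
    using V x s unfolding mild_existence_family_def by blast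
  have "V s x = A I \<oplus>\<^bsub>X\<^esub> C x"
    using I(3) closed[OF s] Cx by (simp add: a_minus_def M.a_assoc M.l_neg)
  with I show "\<exists>I\<in>D. rn_has_integral M X (\<lambda>u. V u x) I 0 s \<and> V s x = A I \<oplus>\<^bsub>X\<^esub> C x"
    by blast
qed

lemma mild_existence_family_uniform_null:
  assumes V: "mild_existence_family M X D A C V" and z: "range z \<subseteq> carrier X"
    and lim: "limitin (rn_topology M X) z \<zero>\<^bsub>X\<^esub> sequentially" and S: "compact S" "S \<subseteq> {0..}"
  shows "rn_uniform_null M X (\<lambda>n s. V s (z n)) S"
proof -
  have VB: "\<And>s. 0 \<le> s \<Longrightarrow> V s \<in> rn_B M X X" and bdd: "locally_as_bounded M X V"
    using V by (auto simp: mild_existence_family_def)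
  have zn: "z n \<in> carrier X" for n using z by blast
  obtain l where l: "0 < l" "S \<subseteq> {0..l}"
    using compact_subset_interval[OF S] .
  obtain K where K: "K \<in> borel_measurable M"
    and le: "\<And>u z. u \<in> {0..l} \<Longrightarrow> z \<in> carrier X \<Longrightarrow> AE w in M. rnorm (V u z) w \<le> K w * rnorm z w"
    using locally_as_bounded_bound[OF VB bdd l(1)] by blast
  show ?thesis
  proof (rule rn_uniform_nullI[OF _ K zn lim])
    fix n s assume s: "s \<in> S"
    show "V s (z n) \<in> carrier X"
      using VB[of s] zn[of n] s S(2) by (force simp: rn_B_def)
    show "AE w in M. rnorm (V s (z n)) w \<le> K w * rnorm (z n) w"
      using s l(2) zn by (intro le) auto
  qed
qed

section \<open>Existence families in the graph norm\<close>

lemma existence_family_bound: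
  assumes V: "existence_family M X D A C V" and "0 < l"
  shows "\<exists>K\<in>borel_measurable M. \<forall>u\<in>{0..l}. \<forall>x\<in>D. AE w in M. graph.rnorm (V u x) w \<le> K w * graph.rnorm x w"
proof -
  have VB: "\<And>s. 0 \<le> s \<Longrightarrow> V s \<in> rn_B M G G" and bdd: "locally_as_bounded M G V"
    using V by (auto simp: existence_family_def)
  show ?thesis
    using graph.locally_as_bounded_bound[OF VB bdd \<open>0 < l\<close>] unfolding graph_module_simps(1) .
qed

lemma existence_family_closed:
  assumes "existence_family M X D A C V" "0 \<le> s" "x \<in> D"
  shows "V s x \<in> D"
proof -
  have "V s \<in> rn_B M G G" using assms by (simp add: existence_family_def)
  then show ?thesis using assms(3) by (auto simp: rn_B_def)
qed

text \<open>V(s) x - C x is the integral of A V(u) x in X, so the derivative is A V(s) x once the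
  integrand is known to be continuous and locally a.s. bounded there.\<close>

lemma existence_family_solution:
  assumes V: "existence_family M X D A C V" and C: "C \<in> rn_B M X X" and x: "x \<in> D"
  shows "acp_solution M X D A (C x) (\<lambda>s. V s x)"
proof -
  have closed: "V s x \<in> D" "V s x \<in> carrier X" "A (V s x) \<in> carrier X" if "0 \<le> s" for s
    using existence_family_closed[OF V that x] domain_subset image_closed by auto
  have Cx: "C x \<in> carrier X"
    using C x domain_subset by (auto simp: rn_B_def)
  have cont: "rn_continuous M G (\<lambda>s. V s x)"
    and int: "\<And>s. 0 \<le> s \<Longrightarrow> rn_has_integral M X (\<lambda>u. A (V u x)) (V s x \<ominus>\<^bsub>X\<^esub> C x) 0 s"
    using V x by (simp_all add: existence_family_def)
  have contA: "rn_continuous M X (\<lambda>s. A (V s x))"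
    using continuous_map_compose[OF cont[unfolded rn_continuous_def] continuous_map_graph_operator]
    by (simp only: rn_continuous_def o_def)
  have bound: "\<exists>B\<in>borel_measurable M. \<forall>t\<in>{0..l}. AE w in M. rnorm (A (V t x)) w \<le> B w" if l: "0 < l" for l
  proof -
    obtain K where K: "K \<in> borel_measurable M"
      and le: "\<forall>u\<in>{0..l}. \<forall>x\<in>D. AE w in M. graph.rnorm (V u x) w \<le> K w * graph.rnorm x w"
      using existence_family_bound[OF V l] by blast
    have "AE w in M. rnorm (A (V t x)) w \<le> K w * graph.rnorm x w" if "t \<in> {0..l}" for t
    proof -
      have "V t x \<in> D" using closed that by simp
      from bspec[OF bspec[OF le that] x] graph_rnorm[OF this] show ?thesis
      proof eventually_elim
        case (elim w)
        have "0 \<le> rnorm (V t x) w" using closed that by (intro rnorm_nonneg) simp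
        with elim show ?case by linarith
      qed
    qed
    then have "\<forall>t\<in>{0..l}. AE w in M. rnorm (A (V t x)) w \<le> K w * graph.rnorm x w" ..
    moreover have "(\<lambda>w. K w * graph.rnorm x w) \<in> borel_measurable M"
      using x by (intro borel_measurable_times K graph.measurable_rnorm) simp
    ultimately show ?thesis by (rule bexI)
  qed
  have "V 0 x \<ominus>\<^bsub>X\<^esub> C x = \<zero>\<^bsub>X\<^esub>"
    by (rule rn_has_integral_singleton[OF int[OF order_refl] closed(3)[OF order_refl]])
  then have V0: "V 0 x = C x"
    using closed(2)[of 0] Cx by (simp add: minus_eq_zero_iff)
  have deriv: "rn_has_deriv M X (\<lambda>s. V s x) (A (V s x)) s" if "0 \<le> s" for s
    by (rule rn_has_deriv_integral[where g = "\<lambda>s. A (V s x)" and F = "\<lambda>s. V s x",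
          OF contA bound closed(2) Cx int that])
  have "\<forall>s\<ge>0. rn_has_deriv M X (\<lambda>s. V s x) (A (V s x)) s"
    using deriv by simp
  with contA have "\<exists>W'. (\<forall>s\<ge>0. rn_has_deriv M X (\<lambda>s. V s x) (W' s) s) \<and> rn_continuous M X W' \<and>
      (\<forall>s>0. W' s = A (V s x))"
    by (intro exI[where x = "\<lambda>s. A (V s x)"]) simp
  with cont V0 show ?thesis
    by (simp only: acp_solution_def simp_thms)
qed

text \<open>By min 1 (a + b) \<le> min 1 a + min 1 b for a, b \<ge> 0, convergence of z and of A z
  to 0 together give convergence in the graph module.\<close>

lemma limitin_graph_zero:
  assumes z: "range z \<subseteq> D" and lim: "limitin (rn_topology M X) z \<zero>\<^bsub>X\<^esub> F"
    and limA: "limitin (rn_topology M X) (\<lambda>n. A (z n)) \<zero>\<^bsub>X\<^esub> F"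
  shows "limitin (rn_topology M G) z \<zero>\<^bsub>X\<^esub> F"
proof -
  have zn: "z n \<in> D" "z n \<in> carrier X" "A (z n) \<in> carrier X" for n
    using z domain_subset image_closed by auto
  have zero: "\<zero>\<^bsub>X\<^esub> \<in> D"
    using graph.M.zero_closed by simp
  have le: "graph.pnorm (z n) \<le> pnorm (z n) + pnorm (A (z n))" for n
  proof -
    have "graph.pnorm (z n) \<le> (\<integral>w. min 1 (rnorm (z n) w) + min 1 (rnorm (A (z n)) w) \<partial>M)"
      unfolding graph.pnorm_def
    proof (rule integral_mono_AE)
      show "AE w in M. min 1 (graph.rnorm (z n) w) \<le> min 1 (rnorm (z n) w) + min 1 (rnorm (A (z n)) w)"
        using graph_rnorm[OF zn(1)[of n]]
        by eventually_elim
          (use rnorm_nonneg[OF zn(2)[of n]] rnorm_nonneg[OF zn(3)[of n]] in \<open>smt (verit) min_def\<close>)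
      show "integrable M (\<lambda>w. min 1 (graph.rnorm (z n) w))"
        using zn by (intro graph.integrable_min_rnorm) simp
    qed (use zn integrable_min_rnorm in auto)
    then show ?thesis
      using zn by (simp add: pnorm_def integrable_min_rnorm)
  qed
  have "((\<lambda>n. pdist (z n) \<zero>\<^bsub>X\<^esub> + pdist (A (z n)) \<zero>\<^bsub>X\<^esub>) \<longlongrightarrow> 0 + 0) F"
    using lim limA unfolding limitin_rn_topology by (intro tendsto_add) auto
  then have lim_sum: "((\<lambda>n. pnorm (z n) + pnorm (A (z n))) \<longlongrightarrow> 0) F"
    using zn by (simp add: pdist_def diff_zero)
  have "((\<lambda>n. graph.pnorm (z n)) \<longlongrightarrow> 0) F"
  proof (rule tendsto_sandwich[OF _ _ tendsto_const lim_sum])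
    show "\<forall>\<^sub>F n in F. 0 \<le> graph.pnorm (z n)"
      using zn by (intro always_eventually allI graph.pnorm_nonneg) simp
  qed (use le in auto)
  moreover have "graph.pdist (z n) \<zero>\<^bsub>X\<^esub> = graph.pnorm (z n)" for n
    using graph.diff_zero[of "z n"] zn zero by (simp add: graph.pdist_def)
  ultimately show ?thesis
    using zn zero by (simp add: graph.limitin_rn_topology)
qed

text \<open>Uniform convergence is obtained once, in the graph norm. A graph neighbourhood of 0 lies
  in the neighbourhoods for x and for A x with the same parameters, which gives both
  conclusions.\<close>

lemma existence_family_uniform_null:
  assumes V: "existence_family M X D A C V" and z: "range z \<subseteq> D"
    and lim: "limitin (rn_topology M X) z \<zero>\<^bsub>X\<^esub> sequentially"
    and limA: "limitin (rn_topology M X) (\<lambda>n. A (z n)) \<zero>\<^bsub>X\<^esub> sequentially"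
    and S: "compact S" "S \<subseteq> {0..}"
  shows "rn_uniform_null M X (\<lambda>n s. V s (z n)) S"
    and "rn_uniform_null M X (\<lambda>n s. A (V s (z n))) S"
proof -
  have zn: "z n \<in> D" for n using z by blast
  obtain l where l: "0 < l" "S \<subseteq> {0..l}"
    using compact_subset_interval[OF S] .
  obtain K where K: "K \<in> borel_measurable M"
    and le: "\<And>u x. u \<in> {0..l} \<Longrightarrow> x \<in> D \<Longrightarrow> AE w in M. graph.rnorm (V u x) w \<le> K w * graph.rnorm x w"
    using existence_family_bound[OF V l(1)] by blast
  have "rn_uniform_null M G (\<lambda>n s. V s (z n)) S"
  proof (rule graph.rn_uniform_nullI[OF _ K])
    fix n s
    show "z n \<in> carrier G" using zn by simp
    assume s: "s \<in> S"
    show "V s (z n) \<in> carrier G"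
      using existence_family_closed[OF V _ zn] s S(2) by auto
    show "AE w in M. graph.rnorm (V s (z n)) w \<le> K w * graph.rnorm (z n) w"
      using s l(2) zn by (intro le) auto
  qed (use limitin_graph_zero[OF z lim limA] in simp)
  then have ev: "\<forall>\<^sub>F n in sequentially. \<forall>s\<in>S. V s (z n) \<in> rn_nbhd M G \<epsilon> l"
    if "0 < \<epsilon>" "l \<in> {0<..<1}" for \<epsilon> l
    using that unfolding rn_uniform_null_def by blast
  show "rn_uniform_null M X (\<lambda>n s. V s (z n)) S"
    unfolding rn_uniform_null_def
    by (intro allI impI ballI, rule eventually_mono[OF ev]) (auto intro: rn_nbhd_graph)
  show "rn_uniform_null M X (\<lambda>n s. A (V s (z n))) S"
    unfolding rn_uniform_null_def
    by (intro allI impI ballI, rule eventually_mono[OF ev]) (auto intro: rn_nbhd_graph)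
qed

end

theorem theorem5p1:
  fixes M :: "'w measure"
    and X :: "('w, 'k::{real_normed_field, euclidean_space}, 'x) rn_struct"
    and D :: "'x set" and A C :: "'x \<Rightarrow> 'x" and V :: "real \<Rightarrow> 'x \<Rightarrow> 'x"
  assumes "rn_module M X" and "rn_complete M X"
    and "submodule D (L0_ring M) X"
    and "A \<in> module_homs (L0_ring M) (X\<lparr>carrier := D\<rparr>) X"
    and "C \<in> rn_B M X X"
  shows
   "(mild_existence_family M X D A C V \<longrightarrow>
      (\<forall>z \<in> C ` carrier X. \<exists>W. acp_mild_solution M X D A z W) \<and>
      (\<forall>z. range z \<subseteq> carrier X \<and> limitin (rn_topology M X) z \<zero>\<^bsub>X\<^esub> sequentially \<longrightarrow>
         (\<forall>n. acp_mild_solution M X D A (C (z n)) (\<lambda>s. V s (z n))) \<and>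
         (\<forall>S. compact S \<and> S \<subseteq> {0..} \<longrightarrow> rn_uniform_null M X (\<lambda>n s. V s (z n)) S))) \<and>
    (existence_family M X D A C V \<longrightarrow>
      (\<forall>z \<in> C ` D. \<exists>W. acp_solution M X D A z W) \<and>
      (\<forall>z. range z \<subseteq> D \<and> limitin (rn_topology M X) z \<zero>\<^bsub>X\<^esub> sequentially \<and>
           limitin (rn_topology M X) (\<lambda>n. A (z n)) \<zero>\<^bsub>X\<^esub> sequentially \<longrightarrow>
         (\<forall>n. acp_solution M X D A (C (z n)) (\<lambda>s. V s (z n))) \<and>
         (\<forall>S. compact S \<and> S \<subseteq> {0..} \<longrightarrow>
            rn_uniform_null M X (\<lambda>n s. V s (z n)) S \<and>
            rn_uniform_null M X (\<lambda>n s. A (V s (z n))) S)))"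
proof -
  interpret rn_operator M X D A
    using assms(1,3,4) by (simp add: rn_operator_def rn_operator_axioms_def)
  show ?thesis
  proof (intro conjI impI ballI allI)
    fix x assume "mild_existence_family M X D A C V" "x \<in> C ` carrier X"
    then show "\<exists>W. acp_mild_solution M X D A x W"
      using mild_existence_family_solution[OF _ assms(5)] by auto
  next
    fix z :: "nat \<Rightarrow> 'x" and n
    assume "mild_existence_family M X D A C V"
      "range z \<subseteq> carrier X \<and> limitin (rn_topology M X) z \<zero>\<^bsub>X\<^esub> sequentially"
    then show "acp_mild_solution M X D A (C (z n)) (\<lambda>s. V s (z n))"
      by (intro mild_existence_family_solution assms(5)) auto
  next
    fix x assume "existence_family M X D A C V" "x \<in> C ` D"
    then show "\<exists>W. acp_solution M X D A x W"
      using existence_family_solution[OF _ assms(5)] by auto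
  next
    fix z :: "nat \<Rightarrow> 'x" and n
    assume "existence_family M X D A C V"
      "range z \<subseteq> D \<and> limitin (rn_topology M X) z \<zero>\<^bsub>X\<^esub> sequentially \<and>
        limitin (rn_topology M X) (\<lambda>n. A (z n)) \<zero>\<^bsub>X\<^esub> sequentially"
    then show "acp_solution M X D A (C (z n)) (\<lambda>s. V s (z n))"
      by (intro existence_family_solution assms(5)) auto
  qed (simp_all only: mild_existence_family_uniform_null existence_family_uniform_null)
qed

end
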